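(* Let $G$ and $H$ be groups, let $\Phi:H\to \mathrm{Out}(G)$ be a homomorphism, and let $E=E(\xi,\varphi)$ be an extension of $G$ by $H$ with coupling $\Phi$. Let $\zeta_1,\zeta_2\in Z^2_\Phi(H,Z(G))$ and let $B:=B^2_\Phi(H,Z(G))$. Then: 1. The function $\Gamma$ (shifted by $\varphi$, i.e. $(\zeta+B)^{\Gamma(x)}:=(\varphi+\zeta)^{\Gamma(x)}-\varphi$ for $x\in \mathrm{Comp}(\Phi)$, $\zeta\in Z^2_\Phi(H,Z(G))$) is a right action of the group $\mathrm{Comp}(\Phi)$ on the set $H^2_\Phi(H,Z(G))$. 2. The extension $E(\xi,\varphi+\zeta_1)$ is $G$-isomorphic to the extension $E(\xi,\varphi+\zeta_2)$ if and only if $\zeta_1+B$ and $\zeta_2+B$ are in the same orbit under $\Gamma$. 3. The stabilizer of $\zeta_1+B$ under $\Gamma$ is the subgroup of inducible pairs for $E(\xi,\varphi+\zeta_1)$. 4. $\mathrm{Inn}(T_\Phi)$ fixes every element of $H^2_\Phi(H,Z(G))$.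
   Context: Conventions: automorphisms act on the right, $g^{\pi_1\pi_2}=(g^{\pi_1})^{\pi_2}$; $g^t=t^{-1}gt$; for $l,\pi\in \mathrm{Aut}(G)$, $l^\pi=\pi^{-1}l\pi$, and $\Phi^\pi(h)=\pi^{-1}\Phi(h)\pi$. $\mathrm{Out}(G)=\mathrm{Aut}(G)/\mathrm{Inn}(G)$. All transversals contain $1$ and factor sets, cocycles and coboundaries are normalized. Extensions. Let $\xi:H\to \mathrm{Aut}(G)$ be a function with $\xi(1)=\mathrm{id}$. A factor set for $\xi$ is a function $\varphi:H\times H\to G$ with $\varphi(h,1)=\varphi(1,h)=1$ such that for all $g\in G$, $u,v,w\in H$: $(g^{\xi(u)})^{\xi(v)}=\varphi(u,v)^{-1}g^{\xi(uv)}\varphi(u,v)$ and $\varphi(uv,w)\varphi(u,v)^{\xi(w)}=\varphi(u,vw)\varphi(v,w)$. Then $E(\xi,\varphi)$ is the group on the set $H\times G$ with product $(u,a)(v,b)=(uv,\varphi(u,v)a^{\xi(v)}b)$; $G$ is identified with $\{(1,a)\}$, a normal subgroup, and $\bar h:=(h,1)$, $h\in H$, is the canonical transversal; $E(\xi,\varphi)/G$ is identified with $H$ via $\bar hG\mapsto h$. $E(\xi,\varphi)$ has coupling $\Phi:H\to\mathrm{Out}(G)$ if $\xi(h)\in\Phi(h)$ for all $h$. Cohomology. $\Phi$ induces an action of $H$ on the abelian group $Z(G)$: $z^{\Phi(h)}:=z^{\xi(h)}$. $Z^2_\Phi(H,Z(G))$ is the abelian group of functions $\zeta:H\times H\to Z(G)$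 with $\zeta(h,1)=\zeta(1,h)=1$ and $\zeta(uv,w)\,\zeta(u,v)^{\Phi(w)}=\zeta(u,vw)\,\zeta(v,w)$; $B^2_\Phi(H,Z(G))$ is the subgroup of functions $(u,v)\mapsto a_u^{\Phi(v)}a_va_{uv}^{-1}$ for functions $h\mapsto a_h$ from $H$ to $Z(G)$ with $a_1=1$; $H^2_\Phi=Z^2_\Phi/B^2_\Phi$. $\varphi+\zeta$ denotes the pointwise product $\varphi(u,v)\zeta(u,v)$ (again a factor set for $\xi$), and $-\varphi$ the corresponding pointwise difference. Compatible pairs. $\mathrm{Comp}(\Phi)$ is the group of pairs $(\omega,\pi)\in \mathrm{Aut}(H)\times \mathrm{Aut}(G)$ with $\Phi(h^\omega)=\Phi^\pi(h)$ for all $h\in H$. Let $T_\Phi=\{(h,l)\in H\times \mathrm{Aut}(G): l\in\Phi(h)\}$; $\mathrm{Comp}(\Phi)$ acts on $T_\Phi$ by $(h,l)^{(\omega,\pi)}=(h^\omega,l^\pi)$. $\mathrm{Inn}(T_\Phi)$ denotes the subgroup of $\mathrm{Comp}(\Phi)$ consisting of the pairs $(c_h,l)$ with $(h,l)\in T_\Phi$, where $c_h$ is conjugation $x\mapsto h^{-1}xh$ in $H$ (the pairs induced by inner automorphisms of extensions with coupling $\Phi$). For $E_1=E(\xi,\varphi_1)$ with coupling $\Phi$ let $\gamma_1:E_1\to T_\Phi$, $e\mapsto(\rho_1(e),f_1(e))$, where $\rho_1:E_1\to H$ is the canonical projection and $f_1(e)$ is the automorphism $g\mapsto e^{-1}ge$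 of $G$. $G$-isomorphisms. A $G$-isomorphism between extensions $E_1,E_2$ of $G$ is an isomorphism $\alpha:E_1\to E_2$ with $\alpha(G)=G$; for extensions of $G$ by $H$ it induces $\pi=\alpha|_G\in \mathrm{Aut}(G)$ and an automorphism $\omega$ of $H$ (through $E_1/G\cong H\cong E_2/G$); if both have coupling $\Phi$ then $(\omega,\pi)\in \mathrm{Comp}(\Phi)$. A pair in $\mathrm{Comp}(\Phi)$ is inducible for $E_1$ if it is induced by a $G$-isomorphism $E_1\to E_1$. Definition of $\Gamma$. For $E_1=E(\xi,\varphi_1)$ with coupling $\Phi$ and $(\omega,\pi)\in \mathrm{Comp}(\Phi)$, $\varphi_1^{\Gamma(\omega,\pi)}$ is the set of all functions $\varphi_2:H\times H\to G$ of the form $\varphi_2(h_1,h_2)=\big((\widehat{h_1h_2})^{-1}\,\widehat{h_1}\,\widehat{h_2}\big)^\pi$ (computed in $E_1$), where $\{\hat h:h\in H\}\subset E_1$ is any family with $\hat 1=1$ and $\gamma_1(\hat h)=\gamma_1(\bar h)^{(\omega^{-1},\pi^{-1})}=(h^{\omega^{-1}},\xi(h)^{\pi^{-1}})$ for all $h$. For a set $X$ of factor sets, $X^{\Gamma(\omega,\pi)}$ is the union of the $\varphi_1^{\Gamma(\omega,\pi)}$, $\varphi_1\in X$; one has $(\varphi_1+B)^{\Gamma(\omega,\pi)}=\varphi_1^{\Gamma(\omega,\pi)}$, and this set is a single coset of $B^2_\Phi(H,Z(G))$. *)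

theory Defs
  imports "HOL-Algebra.Group_Action"
begin

section \<open>Automorphisms, acting on the right\<close>

text \<open>
  \<^const>\<open>AutoGroup\<close> composes automorphisms as functions, so that the left factor is applied last.
  Here automorphisms act on the right: in a product, the left factor is applied first.
\<close>

definition aut_grp :: "('g, 'm) monoid_scheme \<Rightarrow> ('g \<Rightarrow> 'g) monoid"
  where "aut_grp G = (AutoGroup G)\<lparr>mult := \<lambda>\<sigma> \<tau>. \<tau> \<otimes>\<^bsub>AutoGroup G\<^esub> \<sigma>\<rparr>"

definition conj_by :: "('g, 'm) monoid_scheme \<Rightarrow> 'g \<Rightarrow> 'g \<Rightarrow> 'g"
  where "conj_by G t = (\<lambda>x\<in>carrier G. inv\<^bsub>G\<^esub> t \<otimes>\<^bsub>G\<^esub> x \<otimes>\<^bsub>G\<^esub> t)"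

definition inn :: "('g, 'm) monoid_scheme \<Rightarrow> ('g \<Rightarrow> 'g) set"
  where "inn G = conj_by G ` carrier G"

definition out_grp :: "('g, 'm) monoid_scheme \<Rightarrow> ('g \<Rightarrow> 'g) set monoid"
  where "out_grp G = aut_grp G Mod inn G"

definition center :: "('g, 'm) monoid_scheme \<Rightarrow> 'g set"
  where "center G = {z \<in> carrier G. \<forall>g\<in>carrier G. z \<otimes>\<^bsub>G\<^esub> g = g \<otimes>\<^bsub>G\<^esub> z}"


section \<open>Extensions\<close>

text \<open>
  A function from \<open>H \<times> H\<close> to \<open>G\<close> is represented by an extensional function on
  \<open>carrier H \<times> carrier H\<close>, so that equality of such functions, and of sets of them, is the
  intended one. The value \<open>\<xi> u g\<close> is written \<open>g\<close> to the power \<open>\<xi>(u)\<close> in right action notation.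
\<close>

definition factor_set ::
  "('g, 'm) monoid_scheme \<Rightarrow> ('h, 'n) monoid_scheme \<Rightarrow> ('h \<Rightarrow> 'g \<Rightarrow> 'g) \<Rightarrow> ('h \<times> 'h \<Rightarrow> 'g) \<Rightarrow> bool"
  where "factor_set G H \<xi> \<phi> \<longleftrightarrow>
    \<phi> \<in> carrier H \<times> carrier H \<rightarrow>\<^sub>E carrier G \<and>
    (\<forall>h\<in>carrier H. \<phi> (h, \<one>\<^bsub>H\<^esub>) = \<one>\<^bsub>G\<^esub> \<and> \<phi> (\<one>\<^bsub>H\<^esub>, h) = \<one>\<^bsub>G\<^esub>) \<and>
    (\<forall>g\<in>carrier G. \<forall>u\<in>carrier H. \<forall>v\<in>carrier H.
       \<xi> v (\<xi> u g) = inv\<^bsub>G\<^esub> (\<phi> (u, v)) \<otimes>\<^bsub>G\<^esub> \<xi> (u \<otimes>\<^bsub>H\<^esub> v) g \<otimes>\<^bsub>G\<^esub> \<phi> (u, v)) \<and>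
    (\<forall>u\<in>carrier H. \<forall>v\<in>carrier H. \<forall>w\<in>carrier H.
       \<phi> (u \<otimes>\<^bsub>H\<^esub> v, w) \<otimes>\<^bsub>G\<^esub> \<xi> w (\<phi> (u, v)) = \<phi> (u, v \<otimes>\<^bsub>H\<^esub> w) \<otimes>\<^bsub>G\<^esub> \<phi> (v, w))"

definition ext ::
  "('g, 'm) monoid_scheme \<Rightarrow> ('h, 'n) monoid_scheme \<Rightarrow> ('h \<Rightarrow> 'g \<Rightarrow> 'g) \<Rightarrow> ('h \<times> 'h \<Rightarrow> 'g)
   \<Rightarrow> ('h \<times> 'g) monoid"
  where "ext G H \<xi> \<phi> =
    \<lparr>carrier = carrier H \<times> carrier G,
     mult = \<lambda>(u, a) (v, b). (u \<otimes>\<^bsub>H\<^esub> v, \<phi> (u, v) \<otimes>\<^bsub>G\<^esub> \<xi> v a \<otimes>\<^bsub>G\<^esub> b),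
     one = (\<one>\<^bsub>H\<^esub>, \<one>\<^bsub>G\<^esub>)\<rparr>"

definition kernel_copy :: "('g, 'm) monoid_scheme \<Rightarrow> ('h, 'n) monoid_scheme \<Rightarrow> ('h \<times> 'g) set"
  where "kernel_copy G H = {\<one>\<^bsub>H\<^esub>} \<times> carrier G"

definition has_coupling ::
  "('h, 'n) monoid_scheme \<Rightarrow> ('h \<Rightarrow> 'g \<Rightarrow> 'g) \<Rightarrow> ('h \<Rightarrow> ('g \<Rightarrow> 'g) set) \<Rightarrow> bool"
  where "has_coupling H \<xi> \<Phi> \<longleftrightarrow> (\<forall>h\<in>carrier H. \<xi> h \<in> \<Phi> h)"


section \<open>Cohomology\<close>

text \<open>
  The action of \<open>H\<close> on the center of \<open>G\<close> that a coupling \<open>\<Phi>\<close> induces is given by \<open>\<xi>\<close>; the choice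
  of \<open>\<xi> h \<in> \<Phi> h\<close> does not matter, as inner automorphisms fix the center pointwise.
\<close>

definition pw_mult ::
  "('g, 'm) monoid_scheme \<Rightarrow> ('h, 'n) monoid_scheme \<Rightarrow> ('h \<times> 'h \<Rightarrow> 'g) \<Rightarrow> ('h \<times> 'h \<Rightarrow> 'g)
   \<Rightarrow> ('h \<times> 'h \<Rightarrow> 'g)"
  where "pw_mult G H \<phi> \<psi> = (\<lambda>p\<in>carrier H \<times> carrier H. \<phi> p \<otimes>\<^bsub>G\<^esub> \<psi> p)"

definition pw_diff ::
  "('g, 'm) monoid_scheme \<Rightarrow> ('h, 'n) monoid_scheme \<Rightarrow> ('h \<times> 'h \<Rightarrow> 'g) \<Rightarrow> ('h \<times> 'h \<Rightarrow> 'g)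
   \<Rightarrow> ('h \<times> 'h \<Rightarrow> 'g)"
  where "pw_diff G H \<phi> \<psi> = (\<lambda>p\<in>carrier H \<times> carrier H. \<phi> p \<otimes>\<^bsub>G\<^esub> inv\<^bsub>G\<^esub> (\<psi> p))"

definition Z2 ::
  "('g, 'm) monoid_scheme \<Rightarrow> ('h, 'n) monoid_scheme \<Rightarrow> ('h \<Rightarrow> 'g \<Rightarrow> 'g) \<Rightarrow> ('h \<times> 'h \<Rightarrow> 'g) monoid"
  where "Z2 G H \<xi> =
    \<lparr>carrier = {\<zeta> \<in> carrier H \<times> carrier H \<rightarrow>\<^sub>E center G.
       (\<forall>h\<in>carrier H. \<zeta> (h, \<one>\<^bsub>H\<^esub>) = \<one>\<^bsub>G\<^esub> \<and> \<zeta> (\<one>\<^bsub>H\<^esub>, h) = \<one>\<^bsub>G\<^esub>) \<and>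
       (\<forall>u\<in>carrier H. \<forall>v\<in>carrier H. \<forall>w\<in>carrier H.
          \<zeta> (u \<otimes>\<^bsub>H\<^esub> v, w) \<otimes>\<^bsub>G\<^esub> \<xi> w (\<zeta> (u, v)) = \<zeta> (u, v \<otimes>\<^bsub>H\<^esub> w) \<otimes>\<^bsub>G\<^esub> \<zeta> (v, w))},
     mult = pw_mult G H,
     one = (\<lambda>p\<in>carrier H \<times> carrier H. \<one>\<^bsub>G\<^esub>)\<rparr>"

definition B2 ::
  "('g, 'm) monoid_scheme \<Rightarrow> ('h, 'n) monoid_scheme \<Rightarrow> ('h \<Rightarrow> 'g \<Rightarrow> 'g) \<Rightarrow> ('h \<times> 'h \<Rightarrow> 'g) set"
  where "B2 G H \<xi> =
    {\<lambda>(u, v)\<in>carrier H \<times> carrier H. \<xi> v (a u) \<otimes>\<^bsub>G\<^esub> a v \<otimes>\<^bsub>G\<^esub> inv\<^bsub>G\<^esub> (a (u \<otimes>\<^bsub>H\<^esub> v)) | a.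
       a \<in> carrier H \<rightarrow> center G \<and> a \<one>\<^bsub>H\<^esub> = \<one>\<^bsub>G\<^esub>}"

definition H2 ::
  "('g, 'm) monoid_scheme \<Rightarrow> ('h, 'n) monoid_scheme \<Rightarrow> ('h \<Rightarrow> 'g \<Rightarrow> 'g)
   \<Rightarrow> ('h \<times> 'h \<Rightarrow> 'g) set monoid"
  where "H2 G H \<xi> = Z2 G H \<xi> Mod B2 G H \<xi>"

definition coho_class ::
  "('g, 'm) monoid_scheme \<Rightarrow> ('h, 'n) monoid_scheme \<Rightarrow> ('h \<Rightarrow> 'g \<Rightarrow> 'g) \<Rightarrow> ('h \<times> 'h \<Rightarrow> 'g)
   \<Rightarrow> ('h \<times> 'h \<Rightarrow> 'g) set"
  where "coho_class G H \<xi> \<zeta> = B2 G H \<xi> #>\<^bsub>Z2 G H \<xi>\<^esub> \<zeta>"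


section \<open>Compatible pairs\<close>

definition aut_conj :: "('g, 'm) monoid_scheme \<Rightarrow> ('g \<Rightarrow> 'g) \<Rightarrow> ('g \<Rightarrow> 'g) \<Rightarrow> ('g \<Rightarrow> 'g)"
  where "aut_conj G l \<pi> = inv\<^bsub>aut_grp G\<^esub> \<pi> \<otimes>\<^bsub>aut_grp G\<^esub> l \<otimes>\<^bsub>aut_grp G\<^esub> \<pi>"

definition Comp ::
  "('g, 'm) monoid_scheme \<Rightarrow> ('h, 'n) monoid_scheme \<Rightarrow> ('h \<Rightarrow> ('g \<Rightarrow> 'g) set)
   \<Rightarrow> (('h \<Rightarrow> 'h) \<times> ('g \<Rightarrow> 'g)) monoid"
  where "Comp G H \<Phi> = (aut_grp H \<times>\<times> aut_grp G)
    \<lparr>carrier := {(\<omega>, \<pi>). \<omega> \<in> carrier (aut_grp H) \<and> \<pi> \<in> carrier (aut_grp G) \<and>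
       (\<forall>h\<in>carrier H. \<Phi> (\<omega> h) =
          inv\<^bsub>aut_grp G\<^esub> \<pi> <#\<^bsub>aut_grp G\<^esub> \<Phi> h #>\<^bsub>aut_grp G\<^esub> \<pi>)}\<rparr>"

definition T_set ::
  "('g, 'm) monoid_scheme \<Rightarrow> ('h, 'n) monoid_scheme \<Rightarrow> ('h \<Rightarrow> ('g \<Rightarrow> 'g) set) \<Rightarrow> ('h \<times> ('g \<Rightarrow> 'g)) set"
  where "T_set G H \<Phi> = {(h, l). h \<in> carrier H \<and> l \<in> carrier (aut_grp G) \<and> l \<in> \<Phi> h}"

definition T_act ::
  "('g, 'm) monoid_scheme \<Rightarrow> ('h \<times> ('g \<Rightarrow> 'g)) \<Rightarrow> (('h \<Rightarrow> 'h) \<times> ('g \<Rightarrow> 'g)) \<Rightarrow> ('h \<times> ('g \<Rightarrow> 'g))"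
  where "T_act G = (\<lambda>(h, l) (\<omega>, \<pi>). (\<omega> h, aut_conj G l \<pi>))"

definition Inn_T ::
  "('g, 'm) monoid_scheme \<Rightarrow> ('h, 'n) monoid_scheme \<Rightarrow> ('h \<Rightarrow> ('g \<Rightarrow> 'g) set)
   \<Rightarrow> (('h \<Rightarrow> 'h) \<times> ('g \<Rightarrow> 'g)) set"
  where "Inn_T G H \<Phi> = (\<lambda>(h, l). (conj_by H h, l)) ` T_set G H \<Phi>"

definition gamma ::
  "('g, 'm) monoid_scheme \<Rightarrow> ('h, 'n) monoid_scheme \<Rightarrow> ('h \<Rightarrow> 'g \<Rightarrow> 'g) \<Rightarrow> ('h \<times> 'h \<Rightarrow> 'g)
   \<Rightarrow> ('h \<times> 'g) \<Rightarrow> ('h \<times> ('g \<Rightarrow> 'g))"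
  where "gamma G H \<xi> \<phi> e =
    (fst e, \<lambda>g\<in>carrier G. snd (conj_by (ext G H \<xi> \<phi>) e (\<one>\<^bsub>H\<^esub>, g)))"


section \<open>Isomorphisms of extensions\<close>

definition G_isos ::
  "('g, 'm) monoid_scheme \<Rightarrow> ('h, 'n) monoid_scheme \<Rightarrow> ('h \<times> 'g) monoid \<Rightarrow> ('h \<times> 'g) monoid
   \<Rightarrow> ('h \<times> 'g \<Rightarrow> 'h \<times> 'g) set"
  where "G_isos G H E1 E2 =
    {\<alpha> \<in> iso E1 E2. \<alpha> ` kernel_copy G H = kernel_copy G H}"

definition G_isomorphic ::
  "('g, 'm) monoid_scheme \<Rightarrow> ('h, 'n) monoid_scheme \<Rightarrow> ('h \<times> 'g) monoid \<Rightarrow> ('h \<times> 'g) monoid \<Rightarrow> bool"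
  where "G_isomorphic G H E1 E2 \<longleftrightarrow> G_isos G H E1 E2 \<noteq> {}"

text \<open>
  The first component is the composite
  \<open>h \<mapsto> (h, \<one>) G \<mapsto> \<alpha> (h, \<one>) G \<mapsto> fst (\<alpha> (h, \<one>))\<close>.
\<close>

definition induced_pair ::
  "('g, 'm) monoid_scheme \<Rightarrow> ('h, 'n) monoid_scheme \<Rightarrow> ('h \<times> 'g \<Rightarrow> 'h \<times> 'g)
   \<Rightarrow> ('h \<Rightarrow> 'h) \<times> ('g \<Rightarrow> 'g)"
  where "induced_pair G H \<alpha> =
    (\<lambda>h\<in>carrier H. fst (\<alpha> (h, \<one>\<^bsub>G\<^esub>)), \<lambda>g\<in>carrier G. snd (\<alpha> (\<one>\<^bsub>H\<^esub>, g)))"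

definition inducible_pairs ::
  "('g, 'm) monoid_scheme \<Rightarrow> ('h, 'n) monoid_scheme \<Rightarrow> ('h \<Rightarrow> ('g \<Rightarrow> 'g) set)
   \<Rightarrow> ('h \<times> 'g) monoid \<Rightarrow> (('h \<Rightarrow> 'h) \<times> ('g \<Rightarrow> 'g)) set"
  where "inducible_pairs G H \<Phi> E =
    {x \<in> carrier (Comp G H \<Phi>). \<exists>\<alpha>\<in>G_isos G H E E. induced_pair G H \<alpha> = x}"


section \<open>The function \<open>\<Gamma>\<close>\<close>

definition Gamma_fs ::
  "('g, 'm) monoid_scheme \<Rightarrow> ('h, 'n) monoid_scheme \<Rightarrow> ('h \<Rightarrow> 'g \<Rightarrow> 'g)
   \<Rightarrow> ('h \<Rightarrow> 'h) \<times> ('g \<Rightarrow> 'g) \<Rightarrow> ('h \<times> 'h \<Rightarrow> 'g) \<Rightarrow> ('h \<times> 'h \<Rightarrow> 'g) set"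
  where "Gamma_fs G H \<xi> = (\<lambda>(\<omega>, \<pi>) \<phi>.
    let E = ext G H \<xi> \<phi> in
    {\<lambda>(h, k)\<in>carrier H \<times> carrier H. \<pi> (snd (inv\<^bsub>E\<^esub> (t (h \<otimes>\<^bsub>H\<^esub> k)) \<otimes>\<^bsub>E\<^esub> t h \<otimes>\<^bsub>E\<^esub> t k)) | t.
       t \<in> carrier H \<rightarrow> carrier E \<and> t \<one>\<^bsub>H\<^esub> = \<one>\<^bsub>E\<^esub> \<and>
       (\<forall>h\<in>carrier H. gamma G H \<xi> \<phi> (t h) =
          T_act G (gamma G H \<xi> \<phi> (h, \<one>\<^bsub>G\<^esub>)) (inv\<^bsub>aut_grp H\<^esub> \<omega>, inv\<^bsub>aut_grp G\<^esub> \<pi>))})"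

text \<open>
  \<open>Gamma_shift G H \<xi> \<phi> x c\<close> is the result of moving a class \<open>c\<close> of cocycles to the set of
  factor sets \<open>\<phi> + c\<close>, applying \<open>\<Gamma>(x)\<close> to each of its elements, and subtracting \<open>\<phi>\<close> again.
\<close>

definition Gamma_shift ::
  "('g, 'm) monoid_scheme \<Rightarrow> ('h, 'n) monoid_scheme \<Rightarrow> ('h \<Rightarrow> 'g \<Rightarrow> 'g) \<Rightarrow> ('h \<times> 'h \<Rightarrow> 'g)
   \<Rightarrow> ('h \<Rightarrow> 'h) \<times> ('g \<Rightarrow> 'g) \<Rightarrow> ('h \<times> 'h \<Rightarrow> 'g) set \<Rightarrow> ('h \<times> 'h \<Rightarrow> 'g) set"
  where "Gamma_shift G H \<xi> \<phi> x c =
    (\<lambda>\<psi>. pw_diff G H \<psi> \<phi>) ` (\<Union>\<phi>1\<in>pw_mult G H \<phi> ` c. Gamma_fs G H \<xi> x \<phi>1)"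

text \<open>
  The library's \<^const>\<open>group_action\<close> is about left actions. As for its operations \<^const>\<open>orbits\<close>
  and \<^const>\<open>stabilizer\<close>, the group element is the first argument of \<open>act\<close>.
\<close>

definition right_action :: "('k, 'm) monoid_scheme \<Rightarrow> 'x set \<Rightarrow> ('k \<Rightarrow> 'x \<Rightarrow> 'x) \<Rightarrow> bool"
  where "right_action K X act \<longleftrightarrow> group K \<and>
    (\<forall>k\<in>carrier K. \<forall>x\<in>X. act k x \<in> X) \<and>
    (\<forall>x\<in>X. act \<one>\<^bsub>K\<^esub> x = x) \<and>
    (\<forall>k\<in>carrier K. \<forall>l\<in>carrier K. \<forall>x\<in>X. act (k \<otimes>\<^bsub>K\<^esub> l) x = act l (act k x))"

end

theory Submission
  imports Defs
begin

text \<open>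
  The point is that \<open>\<phi>\<^sub>2 \<in> \<phi>\<^sub>1\<^bsup>\<Gamma>(x)\<^esup>\<close> holds if and only if some \<open>G\<close>-isomorphism
  \<open>\<alpha>: E(\<xi>, \<phi>\<^sub>1) \<rightarrow> E(\<xi>, \<phi>\<^sub>2)\<close> induces the pair \<open>x\<close>: the family of lifts that defines \<open>\<phi>\<^sub>2\<close> is the
  preimage under \<open>\<alpha>\<close> of the canonical transversal. Since \<open>G\<close>-isomorphisms can be composed and
  inverted, \<open>\<Gamma>\<close> is an action, its orbits are the \<open>G\<close>-isomorphism classes, and its stabilizers
  consist of the inducible pairs; pairs in \<open>Inn(T\<^sub>\<Phi>)\<close> are induced by inner automorphisms. For
  \<open>x = 1\<close> the definition says directly that \<open>\<phi>\<^sub>1\<^bsup>\<Gamma>(1)\<^esup> = \<phi>\<^sub>1 + B\<close>.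
\<close>

section \<open>Automorphism groups\<close>

text \<open>The lifts lie in E(\<xi>, \<phi>1), and the condition on them involves the inverses of
  \<omega> and \<pi>. Read directly, they therefore describe a map from E(\<xi>, \<phi>2) back to
  E(\<xi>, \<phi>1), which sends (u, g) to the lift of u times the preimage of g under \<pi>; the
  isomorphism \<alpha> is its inverse. The obstacle is that a member of \<open>Gamma_fs\<close> is
  at first only a function with values in G, so that E(\<xi>, \<phi>2) is not yet known to be a
  group. The map is therefore shown to be multiplicative and bijective beforehand, and associativity
  is pulled back along it; associativity is equivalent to the two factor set laws. Compatibility of
  a pair supplies the lifts, so that \<Gamma>(x) never yields the empty set. This gives the harder
  inclusion in the composition law, where an intermediate factor set has to be found. The passage to
  cohomology rests on the shift \<psi> \<mapsto> \<psi> - \<phi>: two factor sets for the same \<xi>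
  differ by central values, so the shift maps factor sets injectively into cocycles.\<close>

lemma (in group) inv_l_cancel [simp]:
  assumes "x \<in> carrier G" "y \<in> carrier G"
  shows "inv x \<otimes> (x \<otimes> y) = y" "x \<otimes> (inv x \<otimes> y) = y"
  using assms by (simp_all flip: m_assoc)

context group
begin

lemma aut_closed: "\<sigma> \<in> carrier (aut_grp G) \<Longrightarrow> x \<in> carrier G \<Longrightarrow> \<sigma> x \<in> carrier G"
  by (auto simp: aut_grp_def AutoGroup_def auto_def hom_def)

lemma aut_mult:
  "\<sigma> \<in> carrier (aut_grp G) \<Longrightarrow> x \<in> carrier G \<Longrightarrow> y \<in> carrier G \<Longrightarrow> \<sigma> (x \<otimes> y) = \<sigma> x \<otimes> \<sigma> y"
  by (auto simp: aut_grp_def AutoGroup_def auto_def hom_def)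

lemma aut_bij: "\<sigma> \<in> carrier (aut_grp G) \<Longrightarrow> bij_betw \<sigma> (carrier G) (carrier G)"
  by (auto simp: aut_grp_def AutoGroup_def auto_def Bij_def)

lemma aut_one: "\<sigma> \<in> carrier (aut_grp G) \<Longrightarrow> \<sigma> \<one> = \<one>"
  using aut_mult[of \<sigma> \<one> \<one>] aut_closed[of \<sigma> \<one>] by simp

lemma aut_inv: "\<sigma> \<in> carrier (aut_grp G) \<Longrightarrow> x \<in> carrier G \<Longrightarrow> \<sigma> (inv x) = inv (\<sigma> x)"
  by (metis aut_closed aut_mult aut_one inv_closed inv_equality l_inv)

lemma aut_eqI:
  assumes "\<sigma> \<in> carrier (aut_grp G)" "\<tau> \<in> carrier (aut_grp G)" "\<And>x. x \<in> carrier G \<Longrightarrow> \<sigma> x = \<tau> x"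
  shows "\<sigma> = \<tau>"
  using assms by (auto simp: aut_grp_def AutoGroup_def auto_def Bij_def intro: extensionalityI)

lemma autI:
  assumes "\<And>x y. x \<in> carrier G \<Longrightarrow> y \<in> carrier G \<Longrightarrow> \<sigma> (x \<otimes> y) = \<sigma> x \<otimes> \<sigma> y"
    and "bij_betw \<sigma> (carrier G) (carrier G)" "\<sigma> \<in> extensional (carrier G)"
  shows "\<sigma> \<in> carrier (aut_grp G)"
  using assms by (auto simp: aut_grp_def AutoGroup_def auto_def Bij_def hom_def dest: bij_betwE)

lemma aut_grp_mult_eq:
  "\<sigma> \<in> carrier (aut_grp G) \<Longrightarrow> \<tau> \<in> carrier (aut_grp G) \<Longrightarrow>
    \<sigma> \<otimes>\<^bsub>aut_grp G\<^esub> \<tau> = compose (carrier G) \<tau> \<sigma>"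
  by (simp add: aut_grp_def AutoGroup_def BijGroup_def auto_def)

lemma aut_grp_mult_apply [simp]:
  "\<sigma> \<in> carrier (aut_grp G) \<Longrightarrow> \<tau> \<in> carrier (aut_grp G) \<Longrightarrow> x \<in> carrier G \<Longrightarrow>
    (\<sigma> \<otimes>\<^bsub>aut_grp G\<^esub> \<tau>) x = \<tau> (\<sigma> x)"
  by (simp add: aut_grp_mult_eq compose_def)

lemma aut_grp_one_apply [simp]: "x \<in> carrier G \<Longrightarrow> \<one>\<^bsub>aut_grp G\<^esub> x = x"
  by (simp add: aut_grp_def AutoGroup_def BijGroup_def)

text \<open>This is the opposite group of \<open>AutoGroup G\<close>: reversing the product
  exchanges left and right inverses, so the old inverses still serve.\<close>

lemma group_aut_grp: "group (aut_grp G)"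
proof -
  interpret A: group "AutoGroup G"
    by (rule AutoGroup)
  have [simp]: "carrier (aut_grp G) = carrier (AutoGroup G)" "\<one>\<^bsub>aut_grp G\<^esub> = \<one>\<^bsub>AutoGroup G\<^esub>"
    "\<And>\<sigma> \<tau>. \<sigma> \<otimes>\<^bsub>aut_grp G\<^esub> \<tau> = \<tau> \<otimes>\<^bsub>AutoGroup G\<^esub> \<sigma>"
    by (simp_all add: aut_grp_def)
  show ?thesis
  proof (rule groupI)
    fix x assume "x \<in> carrier (aut_grp G)"
    then show "\<exists>y\<in>carrier (aut_grp G). y \<otimes>\<^bsub>aut_grp G\<^esub> x = \<one>\<^bsub>aut_grp G\<^esub>"
      by (intro bexI[of _ "inv\<^bsub>AutoGroup G\<^esub> x"]) simp_all
  qed (simp_all add: A.m_assoc)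
qed

interpretation Aut: group "aut_grp G"
  by (rule group_aut_grp)

lemma aut_grp_inv_apply:
  assumes "\<sigma> \<in> carrier (aut_grp G)" "x \<in> carrier G"
  shows "(inv\<^bsub>aut_grp G\<^esub> \<sigma>) (\<sigma> x) = x" "\<sigma> ((inv\<^bsub>aut_grp G\<^esub> \<sigma>) x) = x"
  using Aut.inv_closed[of \<sigma>] aut_grp_mult_apply[of \<sigma> "inv\<^bsub>aut_grp G\<^esub> \<sigma>" x] aut_grp_mult_apply[of "inv\<^bsub>aut_grp G\<^esub> \<sigma>" \<sigma> x] assms
  by simp_all

lemmas aut_simps = aut_closed aut_mult aut_one aut_inv aut_grp_inv_apply

section \<open>Conjugations and cosets of the group of inner automorphisms\<close>

lemma conj_by_apply [simp]: "x \<in> carrier G \<Longrightarrow> conj_by G t x = inv t \<otimes> x \<otimes> t"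
  by (simp add: conj_by_def)

lemma conj_by_aut [simp]:
  assumes t: "t \<in> carrier G"
  shows "conj_by G t \<in> carrier (aut_grp G)"
proof (rule autI)
  show "bij_betw (conj_by G t) (carrier G) (carrier G)"
    by (rule bij_betwI[where g = "conj_by G (inv t)"]) (use t in \<open>auto simp: m_assoc\<close>)
qed (use t in \<open>auto simp: m_assoc conj_by_def\<close>)

lemma conj_by_mult:
  assumes "s \<in> carrier G" "t \<in> carrier G"
  shows "conj_by G (s \<otimes> t) = conj_by G s \<otimes>\<^bsub>aut_grp G\<^esub> conj_by G t"
  by (rule aut_eqI) (use assms in \<open>auto simp: m_assoc inv_mult_group\<close>)

lemma conj_by_inv:
  assumes "t \<in> carrier G"
  shows "conj_by G (inv t) = inv\<^bsub>aut_grp G\<^esub> (conj_by G t)"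
proof -
  have "conj_by G (inv t) \<otimes>\<^bsub>aut_grp G\<^esub> conj_by G t = \<one>\<^bsub>aut_grp G\<^esub>"
    by (rule aut_eqI) (use assms in \<open>auto simp: m_assoc\<close>)
  then show ?thesis
    using assms by (intro Aut.inv_equality[symmetric] conj_by_aut inv_closed)
qed

lemma inn_normal: "inn G \<lhd> aut_grp G"
  unfolding Aut.normal_inv_iff
proof (intro conjI ballI)
  show "subgroup (inn G) (aut_grp G)"
  proof (rule Aut.subgroupI)
    show "inn G \<noteq> {}"
      by (auto simp: inn_def)
  next
    fix a b assume "a \<in> inn G" "b \<in> inn G"
    then show "inv\<^bsub>aut_grp G\<^esub> a \<in> inn G" "a \<otimes>\<^bsub>aut_grp G\<^esub> b \<in> inn G"
      by (force simp: inn_def simp flip: conj_by_mult conj_by_inv)+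
  qed (auto simp: inn_def)
next
  fix \<sigma> \<iota> assume \<sigma>: "\<sigma> \<in> carrier (aut_grp G)" and "\<iota> \<in> inn G"
  then obtain t where t: "t \<in> carrier G" and \<iota>: "\<iota> = conj_by G t"
    by (auto simp: inn_def)
  note [simp] = aut_simps[OF \<sigma>] aut_simps[OF Aut.inv_closed[OF \<sigma>]]
  \<comment> \<open>Here \<sigma> is applied first: g goes to the preimage under \<sigma> of the
    conjugate of \<open>\<sigma> g\<close> by t, so the conjugating element is the preimage of
    t.\<close>
  have "\<sigma> \<otimes>\<^bsub>aut_grp G\<^esub> \<iota> \<otimes>\<^bsub>aut_grp G\<^esub> inv\<^bsub>aut_grp G\<^esub> \<sigma> = conj_by G ((inv\<^bsub>aut_grp G\<^esub> \<sigma>) t)"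
    by (rule aut_eqI) (use \<sigma> t in \<open>auto simp: \<iota>\<close>)
  then show "\<sigma> \<otimes>\<^bsub>aut_grp G\<^esub> \<iota> \<otimes>\<^bsub>aut_grp G\<^esub> inv\<^bsub>aut_grp G\<^esub> \<sigma> \<in> inn G"
    using \<sigma> t by (metis Aut.inv_closed aut_closed imageI inn_def)
qed

interpretation Inn: normal "inn G" "aut_grp G"
  by (rule inn_normal)

text \<open>Conjugation by s followed by l sends g to the conjugate of \<open>l g\<close> by
  \<open>l s\<close>, so s and t correspond under l. The elementwise form is the one that
  calculations in an extension produce.\<close>

lemma inn_coset_iff:
  assumes l: "l \<in> carrier (aut_grp G)"
  shows "k \<in> inn G #>\<^bsub>aut_grp G\<^esub> l \<longleftrightarrow>
    k \<in> carrier (aut_grp G) \<and> (\<exists>t\<in>carrier G. \<forall>g\<in>carrier G. k g = inv t \<otimes> l g \<otimes> t)"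
proof -
  note [simp] = aut_simps[OF l] aut_simps[OF Aut.inv_closed[OF l]]
  show ?thesis
  proof safe
    assume "k \<in> inn G #>\<^bsub>aut_grp G\<^esub> l"
    then obtain s where s: "s \<in> carrier G" and k: "k = conj_by G s \<otimes>\<^bsub>aut_grp G\<^esub> l"
      by (auto simp: inn_def r_coset_def)
    show "k \<in> carrier (aut_grp G)"
      using s l by (simp add: k)
    show "\<exists>t\<in>carrier G. \<forall>g\<in>carrier G. k g = inv t \<otimes> l g \<otimes> t"
      by (rule bexI[of _ "l s"]) (use s l in \<open>auto simp: k\<close>)
  next
    fix t assume k: "k \<in> carrier (aut_grp G)" and t: "t \<in> carrier G"
      and eq: "\<forall>g\<in>carrier G. k g = inv t \<otimes> l g \<otimes> t"
    have "k = conj_by G ((inv\<^bsub>aut_grp G\<^esub> l) t) \<otimes>\<^bsub>aut_grp G\<^esub> l"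
      by (rule aut_eqI) (use k t l eq in auto)
    then show "k \<in> inn G #>\<^bsub>aut_grp G\<^esub> l"
      using t l by (auto simp: r_coset_def inn_def)
  qed
qed

end

text \<open>Normality lets a pass to the other side of the subgroup. This gives the conjugated set
  in the definition of \<open>Comp\<close> an explicit representative.\<close>

lemma (in normal) l_r_coset_eq:
  assumes "a \<in> carrier G" "m \<in> carrier G" "b \<in> carrier G"
  shows "a <# (H #> m) #> b = H #> (a \<otimes> m \<otimes> b)"
proof -
  have "a <# (H #> m) #> b = (a <# H) #> m #> b"
    using assms by (simp add: coset_assoc subset)
  also have "\<dots> = (H #> a) #> m #> b"
    using assms coset_eq by auto
  also have "\<dots> = H #> (a \<otimes> m \<otimes> b)"
    using assms by (simp add: coset_mult_assoc subset m_assoc)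
  finally show ?thesis .
qed


section \<open>Extensions\<close>

text \<open>No factor set is fixed: all extensions in play share G, H, \<Phi> and \<xi>, and differ
  in the factor set alone, which stays a parameter.\<close>

locale coupling = G: group G + H: group H
  for G :: "('g, 'm) monoid_scheme" (structure) and H :: "('h, 'n) monoid_scheme" (structure) +
  fixes \<Phi> :: "'h \<Rightarrow> ('g \<Rightarrow> 'g) set" and \<xi> :: "'h \<Rightarrow> 'g \<Rightarrow> 'g"
  assumes Phi_hom: "\<Phi> \<in> hom H (out_grp G)"
    and xi_funcset: "\<xi> \<in> carrier H \<rightarrow> carrier (aut_grp G)"
    and xi_one: "\<xi> \<one>\<^bsub>H\<^esub> = \<one>\<^bsub>aut_grp G\<^esub>"
    and has_coupling: "has_coupling H \<xi> \<Phi>"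
begin

sublocale AG: group "aut_grp G"
  by (rule G.group_aut_grp)

sublocale AH: group "aut_grp H"
  by (rule H.group_aut_grp)

sublocale IG: normal "inn G" "aut_grp G"
  by (rule G.inn_normal)

abbreviation AG (\<open>\<A>\<^sub>G\<close>) where "\<A>\<^sub>G \<equiv> aut_grp G"
abbreviation AH (\<open>\<A>\<^sub>H\<close>) where "\<A>\<^sub>H \<equiv> aut_grp H"
abbreviation fs where "fs \<equiv> factor_set G H \<xi>"
abbreviation E where "E \<equiv> ext G H \<xi>"

lemma xi_closed [simp]: "u \<in> carrier H \<Longrightarrow> \<xi> u \<in> carrier \<A>\<^sub>G"
  using xi_funcset by auto

lemmas xi_simps [simp] = G.aut_simps[OF xi_closed]

lemma xi_one_apply [simp]: "g \<in> carrier G \<Longrightarrow> \<xi> \<one>\<^bsub>H\<^esub> g = g"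
  by (simp add: xi_one)

lemma carrier_ext [simp]: "carrier (E \<phi>) = carrier H \<times> carrier G"
  and ext_one [simp]: "\<one>\<^bsub>E \<phi>\<^esub> = (\<one>\<^bsub>H\<^esub>, \<one>)"
  and ext_mult [simp]: "(u, a) \<otimes>\<^bsub>E \<phi>\<^esub> (v, b) = (u \<otimes>\<^bsub>H\<^esub> v, \<phi> (u, v) \<otimes> \<xi> v a \<otimes> b)"
  by (simp_all add: ext_def)

lemma fs_closed: "fs \<phi> \<Longrightarrow> u \<in> carrier H \<Longrightarrow> v \<in> carrier H \<Longrightarrow> \<phi> (u, v) \<in> carrier G"
  and fs_funcset: "fs \<phi> \<Longrightarrow> \<phi> \<in> carrier H \<times> carrier H \<rightarrow>\<^sub>E carrier G"
  and fs_one: "fs \<phi> \<Longrightarrow> u \<in> carrier H \<Longrightarrow> \<phi> (u, \<one>\<^bsub>H\<^esub>) = \<one>"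
    "fs \<phi> \<Longrightarrow> u \<in> carrier H \<Longrightarrow> \<phi> (\<one>\<^bsub>H\<^esub>, u) = \<one>"
  by (auto simp: factor_set_def)

lemmas fs_simps = fs_closed fs_one

text \<open>The action law freed of inverses: \<phi>(u, v) can be carried past an element of G,
  which is how the law is used in products.\<close>

lemma fs_xi:
  assumes "fs \<phi>" "u \<in> carrier H" "v \<in> carrier H" "g \<in> carrier G"
  shows "\<phi> (u, v) \<otimes> \<xi> v (\<xi> u g) = \<xi> (u \<otimes>\<^bsub>H\<^esub> v) g \<otimes> \<phi> (u, v)"
proof -
  note [simp] = fs_simps[OF assms(1)]
  have "\<xi> v (\<xi> u g) = inv (\<phi> (u, v)) \<otimes> \<xi> (u \<otimes>\<^bsub>H\<^esub> v) g \<otimes> \<phi> (u, v)"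
    using assms by (simp add: factor_set_def)
  then show ?thesis
    using assms by (simp add: G.m_assoc)
qed

lemma fs_cocycle:
  "fs \<phi> \<Longrightarrow> u \<in> carrier H \<Longrightarrow> v \<in> carrier H \<Longrightarrow> w \<in> carrier H \<Longrightarrow>
    \<phi> (u \<otimes>\<^bsub>H\<^esub> v, w) \<otimes> \<xi> w (\<phi> (u, v)) = \<phi> (u, v \<otimes>\<^bsub>H\<^esub> w) \<otimes> \<phi> (v, w)"
  by (simp add: factor_set_def)

text \<open>Each factor set law accounts for one step: the cocycle law exchanges the values of
  \<phi>, and then the action law carries \<phi>(v, w) past a.\<close>

lemma ext_assoc:
  assumes \<phi>: "fs \<phi>" and u: "u \<in> carrier H" and v: "v \<in> carrier H" and w: "w \<in> carrier H"
    and a: "a \<in> carrier G" and b: "b \<in> carrier G" and c: "c \<in> carrier G"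
  shows "(u, a) \<otimes>\<^bsub>E \<phi>\<^esub> (v, b) \<otimes>\<^bsub>E \<phi>\<^esub> (w, c) = (u, a) \<otimes>\<^bsub>E \<phi>\<^esub> ((v, b) \<otimes>\<^bsub>E \<phi>\<^esub> (w, c))"
proof -
  note [simp] = fs_simps[OF \<phi>]
  have "\<phi> (u \<otimes>\<^bsub>H\<^esub> v, w) \<otimes> \<xi> w (\<phi> (u, v) \<otimes> \<xi> v a \<otimes> b) \<otimes> c =
      (\<phi> (u \<otimes>\<^bsub>H\<^esub> v, w) \<otimes> \<xi> w (\<phi> (u, v))) \<otimes> \<xi> w (\<xi> v a) \<otimes> \<xi> w b \<otimes> c"
    using assms by (simp add: G.m_assoc)
  also have "\<dots> = \<phi> (u, v \<otimes>\<^bsub>H\<^esub> w) \<otimes> (\<phi> (v, w) \<otimes> \<xi> w (\<xi> v a)) \<otimes> \<xi> w b \<otimes> c"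
    using assms by (simp only: fs_cocycle) (simp add: G.m_assoc)
  also have "\<dots> = \<phi> (u, v \<otimes>\<^bsub>H\<^esub> w) \<otimes> \<xi> (v \<otimes>\<^bsub>H\<^esub> w) a \<otimes> (\<phi> (v, w) \<otimes> \<xi> w b \<otimes> c)"
    using assms by (simp only: fs_xi) (simp add: G.m_assoc)
  finally show ?thesis
    using assms by (simp add: H.m_assoc)
qed

text \<open>Associativity on the triple (1, g), (u, 1), (v, 1) is the action law, and on (u, 1), (v,
  1), (w, 1) it is the cocycle law. With this converse of \<open>ext_assoc\<close>, the laws for a
  new \<phi> can be transported from a known extension instead of being computed.\<close>

lemma factor_setI:
  assumes \<phi>: "\<phi> \<in> carrier H \<times> carrier H \<rightarrow>\<^sub>E carrier G"
    and one: "\<And>h. h \<in> carrier H \<Longrightarrow> \<phi> (h, \<one>\<^bsub>H\<^esub>) = \<one>" "\<And>h. h \<in> carrier H \<Longrightarrow> \<phi> (\<one>\<^bsub>H\<^esub>, h) = \<one>"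
    and assoc: "\<And>x y z. x \<in> carrier (E \<phi>) \<Longrightarrow> y \<in> carrier (E \<phi>) \<Longrightarrow> z \<in> carrier (E \<phi>) \<Longrightarrow>
      x \<otimes>\<^bsub>E \<phi>\<^esub> y \<otimes>\<^bsub>E \<phi>\<^esub> z = x \<otimes>\<^bsub>E \<phi>\<^esub> (y \<otimes>\<^bsub>E \<phi>\<^esub> z)"
  shows "fs \<phi>"
proof -
  have [simp]: "\<phi> (u, v) \<in> carrier G" if "u \<in> carrier H" "v \<in> carrier H" for u v
    using \<phi> that by auto
  have "\<xi> v (\<xi> u g) = inv (\<phi> (u, v)) \<otimes> \<xi> (u \<otimes>\<^bsub>H\<^esub> v) g \<otimes> \<phi> (u, v)"
    if "g \<in> carrier G" "u \<in> carrier H" "v \<in> carrier H" for g u v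
  proof -
    have "\<xi> (u \<otimes>\<^bsub>H\<^esub> v) g \<otimes> \<phi> (u, v) = \<phi> (u, v) \<otimes> \<xi> v (\<xi> u g)"
      using assoc[of "(\<one>\<^bsub>H\<^esub>, g)" "(u, \<one>)" "(v, \<one>)"] that by (simp add: one)
    then show ?thesis
      using that by (simp add: G.m_assoc)
  qed
  moreover have "\<phi> (u \<otimes>\<^bsub>H\<^esub> v, w) \<otimes> \<xi> w (\<phi> (u, v)) = \<phi> (u, v \<otimes>\<^bsub>H\<^esub> w) \<otimes> \<phi> (v, w)"
    if "u \<in> carrier H" "v \<in> carrier H" "w \<in> carrier H" for u v w
    using assoc[of "(u, \<one>)" "(v, \<one>)" "(w, \<one>)"] that by simp
  ultimately show ?thesis
    using \<phi> one by (simp add: factor_set_def)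
qed

lemma group_ext:
  assumes \<phi>: "fs \<phi>"
  shows "group (E \<phi>)"
proof (rule groupI)
  note [simp] = fs_simps[OF \<phi>]
  show "x \<otimes>\<^bsub>E \<phi>\<^esub> y \<otimes>\<^bsub>E \<phi>\<^esub> z = x \<otimes>\<^bsub>E \<phi>\<^esub> (y \<otimes>\<^bsub>E \<phi>\<^esub> z)"
    if "x \<in> carrier (E \<phi>)" "y \<in> carrier (E \<phi>)" "z \<in> carrier (E \<phi>)" for x y z
    using that ext_assoc[OF \<phi>] by (cases x; cases y; cases z) (simp del: ext_mult)
next
  fix x assume "x \<in> carrier (E \<phi>)"
  then obtain u a where x: "x = (u, a)" "u \<in> carrier H" "a \<in> carrier G"
    by auto
  let ?v = "inv\<^bsub>H\<^esub> u"
  \<comment> \<open>The solution b of \<phi>(v, u) (\<xi> u b) a = 1, which is the second coordinate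
    of (v, b) (u, a).\<close>
  let ?b = "(inv\<^bsub>\<A>\<^sub>G\<^esub> (\<xi> u)) (inv (\<phi> (?v, u)) \<otimes> inv a)"
  have "?b \<in> carrier G"
    using x by (simp add: G.aut_closed[OF AG.inv_closed[OF xi_closed]] fs_simps[OF \<phi>])
  then show "\<exists>y\<in>carrier (E \<phi>). y \<otimes>\<^bsub>E \<phi>\<^esub> x = \<one>\<^bsub>E \<phi>\<^esub>"
    using x \<phi> by (intro bexI[of _ "(?v, ?b)"]) (simp_all add: G.m_assoc fs_simps[OF \<phi>])
qed (auto simp: fs_simps[OF \<phi>])

lemma kernel_mult [simp]:
  assumes "fs \<phi>" "u \<in> carrier H" "a \<in> carrier G" "g \<in> carrier G"
  shows "(u, a) \<otimes>\<^bsub>E \<phi>\<^esub> (\<one>\<^bsub>H\<^esub>, g) = (u, a \<otimes> g)"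
    "(\<one>\<^bsub>H\<^esub>, g) \<otimes>\<^bsub>E \<phi>\<^esub> (u, a) = (u, \<xi> u g \<otimes> a)"
  using assms by (simp_all add: fs_simps[OF assms(1)])

lemma conj_by_ext:
  assumes \<phi>: "fs \<phi>" and u: "u \<in> carrier H" and a: "a \<in> carrier G" and g: "g \<in> carrier G"
  shows "conj_by (E \<phi>) (u, a) (\<one>\<^bsub>H\<^esub>, g) = (\<one>\<^bsub>H\<^esub>, inv a \<otimes> \<xi> u g \<otimes> a)"
proof -
  note [simp] = fs_simps[OF \<phi>]
  interpret E: group "E \<phi>"
    by (rule group_ext) fact
  \<comment> \<open>Comparing g e with e g', for e = (u, a), avoids an explicit formula for the
    inverse of e.\<close>
  have "(\<one>\<^bsub>H\<^esub>, g) \<otimes>\<^bsub>E \<phi>\<^esub> (u, a) = (u, a) \<otimes>\<^bsub>E \<phi>\<^esub> (\<one>\<^bsub>H\<^esub>, inv a \<otimes> \<xi> u g \<otimes> a)"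
    using assms by (simp add: G.m_assoc)
  then have "inv\<^bsub>E \<phi>\<^esub> (u, a) \<otimes>\<^bsub>E \<phi>\<^esub> ((\<one>\<^bsub>H\<^esub>, g) \<otimes>\<^bsub>E \<phi>\<^esub> (u, a)) = (\<one>\<^bsub>H\<^esub>, inv a \<otimes> \<xi> u g \<otimes> a)"
    using assms by (simp del: ext_mult kernel_mult)
  then show ?thesis
    using assms E.inv_closed[of "(u, a)"] by (simp add: E.m_assoc del: ext_mult kernel_mult)
qed

lemma gamma_eq:
  assumes "fs \<phi>" "u \<in> carrier H" "a \<in> carrier G"
  shows "gamma G H \<xi> \<phi> (u, a) = (u, \<lambda>g\<in>carrier G. inv a \<otimes> \<xi> u g \<otimes> a)"
  using assms by (auto simp: gamma_def conj_by_ext intro: restrict_ext)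


section \<open>Compatible pairs\<close>

lemma Phi_eq_coset:
  assumes "h \<in> carrier H" "l \<in> \<Phi> h"
  shows "\<Phi> h = inn G #>\<^bsub>\<A>\<^sub>G\<^esub> l"
proof -
  have "\<Phi> h \<in> rcosets\<^bsub>\<A>\<^sub>G\<^esub> inn G"
    using Phi_hom assms(1) by (auto simp: hom_def out_grp_def FactGroup_def)
  then obtain a where "a \<in> carrier \<A>\<^sub>G" "\<Phi> h = inn G #>\<^bsub>\<A>\<^sub>G\<^esub> a"
    unfolding RCOSETS_def by blast
  then show ?thesis
    using assms(2) AG.repr_independence[OF _ _ IG.subgroup_axioms] by blast
qed

lemma xi_in_Phi: "h \<in> carrier H \<Longrightarrow> \<xi> h \<in> \<Phi> h"
  using has_coupling by (simp add: has_coupling_def)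

lemma Phi_subset: "h \<in> carrier H \<Longrightarrow> \<Phi> h \<subseteq> carrier \<A>\<^sub>G"
  using Phi_eq_coset[OF _ xi_in_Phi] AG.r_coset_subset_G[OF IG.subset] by simp

lemma Phi_mult: "h \<in> carrier H \<Longrightarrow> k \<in> carrier H \<Longrightarrow> \<Phi> (h \<otimes>\<^bsub>H\<^esub> k) = \<Phi> h <#>\<^bsub>\<A>\<^sub>G\<^esub> \<Phi> k"
  using Phi_hom by (simp add: hom_def out_grp_def FactGroup_def)

lemma Phi_mult_mem:
  "h \<in> carrier H \<Longrightarrow> k \<in> carrier H \<Longrightarrow> l \<in> \<Phi> h \<Longrightarrow> m \<in> \<Phi> k \<Longrightarrow> l \<otimes>\<^bsub>\<A>\<^sub>G\<^esub> m \<in> \<Phi> (h \<otimes>\<^bsub>H\<^esub> k)"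
  by (auto simp: Phi_mult set_mult_def)

lemma mem_Phi_iff:
  "h \<in> carrier H \<Longrightarrow> l \<in> \<Phi> h \<longleftrightarrow>
    l \<in> carrier \<A>\<^sub>G \<and> (\<exists>t\<in>carrier G. \<forall>g\<in>carrier G. l g = inv t \<otimes> \<xi> h g \<otimes> t)"
  by (simp add: Phi_eq_coset[OF _ xi_in_Phi] G.inn_coset_iff)

lemma Phi_inv_mem:
  assumes h: "h \<in> carrier H" and l: "l \<in> \<Phi> h"
  shows "inv\<^bsub>\<A>\<^sub>G\<^esub> l \<in> \<Phi> (inv\<^bsub>H\<^esub> h)"
proof -
  have lc: "l \<in> carrier \<A>\<^sub>G"
    using h l Phi_subset by auto
  have one: "inn G = \<Phi> \<one>\<^bsub>H\<^esub>"
    using Phi_eq_coset[OF H.one_closed xi_in_Phi] IG.subset by (simp add: xi_one)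
  obtain m where m: "m \<in> \<Phi> (inv\<^bsub>H\<^esub> h)"
    using xi_in_Phi h H.inv_closed by blast
  have mc: "m \<in> carrier \<A>\<^sub>G"
    using h m Phi_subset by auto
  have "m \<otimes>\<^bsub>\<A>\<^sub>G\<^esub> l \<in> inn G"
    using Phi_mult_mem[OF _ h m l] h by (simp add: one)
  then have "inv\<^bsub>\<A>\<^sub>G\<^esub> (m \<otimes>\<^bsub>\<A>\<^sub>G\<^esub> l) \<in> inn G"
    by simp
  then have "inv\<^bsub>\<A>\<^sub>G\<^esub> l \<otimes>\<^bsub>\<A>\<^sub>G\<^esub> inv\<^bsub>\<A>\<^sub>G\<^esub> m \<in> inn G"
    using lc mc by (simp add: AG.inv_mult_group)
  then have "inv\<^bsub>\<A>\<^sub>G\<^esub> l \<otimes>\<^bsub>\<A>\<^sub>G\<^esub> inv\<^bsub>\<A>\<^sub>G\<^esub> m \<otimes>\<^bsub>\<A>\<^sub>G\<^esub> m \<in> \<Phi> (inv\<^bsub>H\<^esub> h)"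
    using m h Phi_mult_mem[of "\<one>\<^bsub>H\<^esub>" "inv\<^bsub>H\<^esub> h"] by (simp add: one)
  then show ?thesis
    using lc mc by (simp add: AG.m_assoc)
qed

lemma Phi_conj:
  assumes h: "h \<in> carrier H" and \<pi>: "\<pi> \<in> carrier \<A>\<^sub>G" and l: "l \<in> \<Phi> h"
  shows "inv\<^bsub>\<A>\<^sub>G\<^esub> \<pi> <#\<^bsub>\<A>\<^sub>G\<^esub> \<Phi> h #>\<^bsub>\<A>\<^sub>G\<^esub> \<pi> = inn G #>\<^bsub>\<A>\<^sub>G\<^esub> (inv\<^bsub>\<A>\<^sub>G\<^esub> \<pi> \<otimes>\<^bsub>\<A>\<^sub>G\<^esub> l \<otimes>\<^bsub>\<A>\<^sub>G\<^esub> \<pi>)"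
  using assms Phi_subset[OF h] by (simp add: Phi_eq_coset[OF h l] IG.l_r_coset_eq subset_iff)

lemma compatible_iff:
  assumes \<omega>: "\<omega> \<in> carrier \<A>\<^sub>H" and \<pi>: "\<pi> \<in> carrier \<A>\<^sub>G" and h: "h \<in> carrier H"
  shows "\<Phi> (\<omega> h) = inv\<^bsub>\<A>\<^sub>G\<^esub> \<pi> <#\<^bsub>\<A>\<^sub>G\<^esub> \<Phi> h #>\<^bsub>\<A>\<^sub>G\<^esub> \<pi> \<longleftrightarrow>
    (\<exists>t\<in>carrier G. \<forall>g\<in>carrier G. \<xi> (\<omega> h) (\<pi> g) = inv t \<otimes> \<pi> (\<xi> h g) \<otimes> t)" (is "?L \<longleftrightarrow> ?R")
proof -
  note [simp] = G.aut_simps[OF \<pi>] G.aut_simps[OF AG.inv_closed[OF \<pi>]] H.aut_simps[OF \<omega>]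
  have \<omega>h: "\<omega> h \<in> carrier H"
    using h by simp
  let ?l = "inv\<^bsub>\<A>\<^sub>G\<^esub> \<pi> \<otimes>\<^bsub>\<A>\<^sub>G\<^esub> \<xi> h \<otimes>\<^bsub>\<A>\<^sub>G\<^esub> \<pi>"
  have l: "?l \<in> carrier \<A>\<^sub>G"
    using \<pi> h by simp
  \<comment> \<open>Both sides are cosets of \<open>inn G\<close>, so they are equal as soon as the
    representative \<xi>(\<omega> h) of the first lies in the second.\<close>
  have "?L \<longleftrightarrow> \<xi> (\<omega> h) \<in> inn G #>\<^bsub>\<A>\<^sub>G\<^esub> ?l"
    using Phi_conj[OF h \<pi> xi_in_Phi[OF h]] Phi_eq_coset[OF \<omega>h xi_in_Phi[OF \<omega>h]] xi_in_Phi[OF \<omega>h]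
      AG.repr_independence[OF _ l IG.subgroup_axioms] by metis
  also have "\<dots> \<longleftrightarrow> (\<exists>t\<in>carrier G. \<forall>g\<in>carrier G. \<xi> (\<omega> h) g = inv t \<otimes> \<pi> (\<xi> h ((inv\<^bsub>\<A>\<^sub>G\<^esub> \<pi>) g)) \<otimes> t)"
    using G.inn_coset_iff[OF l] \<omega>h \<pi> h by simp
  \<comment> \<open>Every element of G has the form \<pi> g, and substituting it removes the inverse
    of \<pi>.\<close>
  also have "\<dots> \<longleftrightarrow> ?R"
    by (intro bex_cong refl iffI ballI; metis G.aut_closed G.aut_grp_inv_apply \<pi> AG.inv_closed)
  finally show ?thesis .
qed

abbreviation C where "C \<equiv> Comp G H \<Phi>"

text \<open>In this form compatibility can be compared with the equations of a G-isomorphism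
  \<alpha>: there t is the inverse of the second coordinate of \<alpha>(h, 1).\<close>

lemma mem_Comp_iff:
  "(\<omega>, \<pi>) \<in> carrier C \<longleftrightarrow> \<omega> \<in> carrier \<A>\<^sub>H \<and> \<pi> \<in> carrier \<A>\<^sub>G \<and>
    (\<forall>h\<in>carrier H. \<exists>t\<in>carrier G. \<forall>g\<in>carrier G. \<xi> (\<omega> h) (\<pi> g) = inv t \<otimes> \<pi> (\<xi> h g) \<otimes> t)"
  by (simp add: Comp_def compatible_iff cong: conj_cong)

lemma Comp_subgroup: "subgroup (carrier C) (\<A>\<^sub>H \<times>\<times> \<A>\<^sub>G)"
proof -
  interpret P: group "\<A>\<^sub>H \<times>\<times> \<A>\<^sub>G"
    by (rule DirProd_group) unfold_locales
  let ?c = "\<lambda>\<omega> \<pi> h. \<Phi> (\<omega> h) = inv\<^bsub>\<A>\<^sub>G\<^esub> \<pi> <#\<^bsub>\<A>\<^sub>G\<^esub> \<Phi> h #>\<^bsub>\<A>\<^sub>G\<^esub> \<pi>"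
  have carrier_C: "carrier C = {(\<omega>, \<pi>). \<omega> \<in> carrier \<A>\<^sub>H \<and> \<pi> \<in> carrier \<A>\<^sub>G \<and> (\<forall>h\<in>carrier H. ?c \<omega> \<pi> h)}"
    by (simp add: Comp_def)
  show ?thesis
  proof (rule P.subgroupI)
    show "carrier C \<subseteq> carrier (\<A>\<^sub>H \<times>\<times> \<A>\<^sub>G)"
      by (auto simp: carrier_C)
    have "(\<one>\<^bsub>\<A>\<^sub>H\<^esub>, \<one>\<^bsub>\<A>\<^sub>G\<^esub>) \<in> carrier C"
      by (auto simp: mem_Comp_iff intro!: bexI[of _ "\<one>"])
    then show "carrier C \<noteq> {}"
      by blast
  next
    fix x assume "x \<in> carrier C"
    then obtain \<omega> \<pi> where x: "x = (\<omega>, \<pi>)" and \<omega>: "\<omega> \<in> carrier \<A>\<^sub>H" and \<pi>: "\<pi> \<in> carrier \<A>\<^sub>G"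
      and c: "\<And>h. h \<in> carrier H \<Longrightarrow> ?c \<omega> \<pi> h"
      by (auto simp: carrier_C)
    note [simp] = H.aut_simps[OF \<omega>] H.aut_simps[OF AH.inv_closed[OF \<omega>]]
    have "?c (inv\<^bsub>\<A>\<^sub>H\<^esub> \<omega>) (inv\<^bsub>\<A>\<^sub>G\<^esub> \<pi>) h" if h: "h \<in> carrier H" for h
    proof -
      \<comment> \<open>Compatibility is applied at the preimage of h, where it expresses \<Phi>(h)
        as a conjugate of \<Phi>(k); the two conjugations then cancel.\<close>
      let ?k = "(inv\<^bsub>\<A>\<^sub>H\<^esub> \<omega>) h"
      have "inv\<^bsub>\<A>\<^sub>G\<^esub> (inv\<^bsub>\<A>\<^sub>G\<^esub> \<pi>) <#\<^bsub>\<A>\<^sub>G\<^esub> \<Phi> h #>\<^bsub>\<A>\<^sub>G\<^esub> inv\<^bsub>\<A>\<^sub>G\<^esub> \<pi>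
          = \<pi> <#\<^bsub>\<A>\<^sub>G\<^esub> (inv\<^bsub>\<A>\<^sub>G\<^esub> \<pi> <#\<^bsub>\<A>\<^sub>G\<^esub> \<Phi> ?k #>\<^bsub>\<A>\<^sub>G\<^esub> \<pi>) #>\<^bsub>\<A>\<^sub>G\<^esub> inv\<^bsub>\<A>\<^sub>G\<^esub> \<pi>"
        using c[of ?k] h \<pi> by simp
      also have "\<dots> = \<Phi> ?k"
        using h \<pi> Phi_subset[of ?k]
        by (simp add: AG.coset_assoc AG.lcos_m_assoc AG.coset_mult_assoc AG.l_coset_subset_G
            AG.lcos_mult_one)
      finally show ?thesis
        by simp
    qed
    then show "inv\<^bsub>\<A>\<^sub>H \<times>\<times> \<A>\<^sub>G\<^esub> x \<in> carrier C"
      using \<omega> \<pi> by (simp add: x inv_DirProd[OF AH.is_group AG.is_group] carrier_C)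
  next
    fix x y assume "x \<in> carrier C" "y \<in> carrier C"
    then obtain \<omega> \<pi> \<omega>' \<pi>' where xy: "x = (\<omega>, \<pi>)" "y = (\<omega>', \<pi>')"
      and \<omega>: "\<omega> \<in> carrier \<A>\<^sub>H" "\<omega>' \<in> carrier \<A>\<^sub>H" and \<pi>: "\<pi> \<in> carrier \<A>\<^sub>G" "\<pi>' \<in> carrier \<A>\<^sub>G"
      and c: "\<And>h. h \<in> carrier H \<Longrightarrow> ?c \<omega> \<pi> h" "\<And>h. h \<in> carrier H \<Longrightarrow> ?c \<omega>' \<pi>' h"
      by (auto simp: carrier_C)
    note [simp] = H.aut_simps[OF \<omega>(1)] H.aut_simps[OF \<omega>(2)]
    have "?c (\<omega> \<otimes>\<^bsub>\<A>\<^sub>H\<^esub> \<omega>') (\<pi> \<otimes>\<^bsub>\<A>\<^sub>G\<^esub> \<pi>') h" if h: "h \<in> carrier H" for h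
      using h \<omega> \<pi> c Phi_subset[of h]
      by (simp add: AG.coset_assoc AG.lcos_m_assoc AG.coset_mult_assoc AG.l_coset_subset_G
          AG.inv_mult_group)
    then show "x \<otimes>\<^bsub>\<A>\<^sub>H \<times>\<times> \<A>\<^sub>G\<^esub> y \<in> carrier C"
      using \<omega> \<pi> by (simp add: xy carrier_C)
  qed
qed

lemma Comp_eq: "C = (\<A>\<^sub>H \<times>\<times> \<A>\<^sub>G)\<lparr>carrier := carrier C\<rparr>"
  by (simp add: Comp_def)

sublocale P: group "\<A>\<^sub>H \<times>\<times> \<A>\<^sub>G"
  by (rule DirProd_group) unfold_locales

sublocale C: group C
  using subgroup.subgroup_is_group[OF Comp_subgroup P.is_group] Comp_eq by simp

lemma Comp_mult [simp]: "(\<omega>, \<pi>) \<otimes>\<^bsub>C\<^esub> (\<omega>', \<pi>') = (\<omega> \<otimes>\<^bsub>\<A>\<^sub>H\<^esub> \<omega>', \<pi> \<otimes>\<^bsub>\<A>\<^sub>G\<^esub> \<pi>')"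
  by (simp add: Comp_def)

lemma Comp_one: "\<one>\<^bsub>C\<^esub> = (\<one>\<^bsub>\<A>\<^sub>H\<^esub>, \<one>\<^bsub>\<A>\<^sub>G\<^esub>)"
  by (simp add: Comp_def DirProd_def)

lemma Comp_inv:
  assumes "(\<omega>, \<pi>) \<in> carrier C"
  shows "inv\<^bsub>C\<^esub> (\<omega>, \<pi>) = (inv\<^bsub>\<A>\<^sub>H\<^esub> \<omega>, inv\<^bsub>\<A>\<^sub>G\<^esub> \<pi>)"
  using P.m_inv_consistent[OF Comp_subgroup assms] assms Comp_eq
    inv_DirProd[OF AH.is_group AG.is_group, of \<omega> \<pi>]
  by (simp add: mem_Comp_iff)

text \<open>Since \<Phi> is multiplicative, conjugating \<Phi>(k) by l in \<Phi>(h) gives \<Phi> at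
  the conjugate of k by h, so the pairs are compatible. Closure holds because (h, l) \<mapsto> (c,
  l), with c the conjugation by h, respects products and inverses.\<close>

lemma Inn_T_subgroup: "subgroup (Inn_T G H \<Phi>) C"
proof (rule C.subgroupI)
  have T: "T_set G H \<Phi> = {(h, l). h \<in> carrier H \<and> l \<in> \<Phi> h}"
    using Phi_subset by (auto simp: T_set_def)
  show sub: "Inn_T G H \<Phi> \<subseteq> carrier C"
  proof
    fix x assume "x \<in> Inn_T G H \<Phi>"
    then obtain h l where x: "x = (conj_by H h, l)" and h: "h \<in> carrier H" and l: "l \<in> \<Phi> h"
      by (auto simp: Inn_T_def T)
    have lc: "l \<in> carrier \<A>\<^sub>G"
      using h l Phi_subset by auto
    have "\<Phi> (conj_by H h k) = inv\<^bsub>\<A>\<^sub>G\<^esub> l <#\<^bsub>\<A>\<^sub>G\<^esub> \<Phi> k #>\<^bsub>\<A>\<^sub>G\<^esub> l" if k: "k \<in> carrier H" for k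
    proof -
      have "inv\<^bsub>\<A>\<^sub>G\<^esub> l \<otimes>\<^bsub>\<A>\<^sub>G\<^esub> \<xi> k \<otimes>\<^bsub>\<A>\<^sub>G\<^esub> l \<in> \<Phi> (inv\<^bsub>H\<^esub> h \<otimes>\<^bsub>H\<^esub> k \<otimes>\<^bsub>H\<^esub> h)"
        using h k l by (intro Phi_mult_mem Phi_inv_mem xi_in_Phi) auto
      then show ?thesis
        using h k Phi_conj[OF k lc xi_in_Phi[OF k]] Phi_eq_coset by simp
    qed
    then show "x \<in> carrier C"
      using h lc by (simp add: x Comp_def)
  qed
  show "Inn_T G H \<Phi> \<noteq> {}"
    using xi_in_Phi by (auto simp: Inn_T_def T)
  show "inv\<^bsub>C\<^esub> x \<in> Inn_T G H \<Phi>" if "x \<in> Inn_T G H \<Phi>" for x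
  proof -
    from that obtain h l where x: "x = (conj_by H h, l)" and h: "h \<in> carrier H" and l: "l \<in> \<Phi> h"
      by (auto simp: Inn_T_def T)
    have "inv\<^bsub>C\<^esub> x = (conj_by H (inv\<^bsub>H\<^esub> h), inv\<^bsub>\<A>\<^sub>G\<^esub> l)"
      using that sub h by (auto simp: x Comp_inv H.conj_by_inv)
    then show ?thesis
      using h l Phi_inv_mem by (auto simp: Inn_T_def T)
  qed
  show "x \<otimes>\<^bsub>C\<^esub> y \<in> Inn_T G H \<Phi>" if xy: "x \<in> Inn_T G H \<Phi>" "y \<in> Inn_T G H \<Phi>" for x y
  proof -
    from xy obtain h l k m where x: "x = (conj_by H h, l)" "y = (conj_by H k, m)"
      and h: "h \<in> carrier H" "k \<in> carrier H" and l: "l \<in> \<Phi> h" "m \<in> \<Phi> k"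
      by (auto simp: Inn_T_def T)
    have "x \<otimes>\<^bsub>C\<^esub> y = (conj_by H (h \<otimes>\<^bsub>H\<^esub> k), l \<otimes>\<^bsub>\<A>\<^sub>G\<^esub> m)"
      using h by (simp add: x H.conj_by_mult)
    then show ?thesis
      using h l Phi_mult_mem by (auto simp: Inn_T_def T)
  qed
qed

end


section \<open>Isomorphisms of extensions\<close>

context coupling
begin

abbreviation Isos where "Isos \<phi> \<psi> \<equiv> G_isos G H (E \<phi>) (E \<psi>)"

text \<open>As \<alpha> preserves the copy of G, it acts there as \<pi>, and the factorization (u,
  g) = (u, 1) (1, g) determines it everywhere. Surjectivity of \<pi> uses that the image of the copy
  of G is all of it.\<close>

lemma G_iso_shape:
  assumes \<phi>: "fs \<phi>" and \<psi>: "fs \<psi>" and \<alpha>: "\<alpha> \<in> Isos \<phi> \<psi>" and pair: "induced_pair G H \<alpha> = (\<omega>, \<pi>)"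
  shows "\<omega> \<in> carrier \<A>\<^sub>H" "\<pi> \<in> carrier \<A>\<^sub>G"
    and "\<And>u g. u \<in> carrier H \<Longrightarrow> g \<in> carrier G \<Longrightarrow> \<alpha> (u, g) = (\<omega> u, snd (\<alpha> (u, \<one>)) \<otimes> \<pi> g)"
    and "\<And>u. u \<in> carrier H \<Longrightarrow> snd (\<alpha> (u, \<one>)) \<in> carrier G"
proof -
  define d where "d u = snd (\<alpha> (u, \<one>))" for u
  have \<omega>_def: "\<omega> = (\<lambda>u\<in>carrier H. fst (\<alpha> (u, \<one>)))" and \<pi>_def: "\<pi> = (\<lambda>g\<in>carrier G. snd (\<alpha> (\<one>\<^bsub>H\<^esub>, g)))"
    using pair by (auto simp: induced_pair_def)
  have hom: "\<alpha> (x \<otimes>\<^bsub>E \<phi>\<^esub> y) = \<alpha> x \<otimes>\<^bsub>E \<psi>\<^esub> \<alpha> y" if "x \<in> carrier (E \<phi>)" "y \<in> carrier (E \<phi>)" for x y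
    using \<alpha> that by (auto simp: G_isos_def iso_def hom_def)
  have bij: "bij_betw \<alpha> (carrier H \<times> carrier G) (carrier H \<times> carrier G)"
    using \<alpha> by (simp add: G_isos_def iso_def)
  have ker: "\<alpha> ` ({\<one>\<^bsub>H\<^esub>} \<times> carrier G) = {\<one>\<^bsub>H\<^esub>} \<times> carrier G"
    using \<alpha> by (simp add: G_isos_def kernel_copy_def)
  have \<alpha>_u: "\<alpha> (u, \<one>) = (\<omega> u, d u)" and closed: "\<omega> u \<in> carrier H" "d u \<in> carrier G"
    if "u \<in> carrier H" for u
    using that bij_betwE[OF bij, THEN bspec, of "(u, \<one>)"] by (simp_all add: \<omega>_def d_def mem_Times_iff)
  have \<alpha>_g: "\<alpha> (\<one>\<^bsub>H\<^esub>, g) = (\<one>\<^bsub>H\<^esub>, \<pi> g)" and \<pi>_closed: "\<pi> g \<in> carrier G" if g: "g \<in> carrier G" for g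
  proof -
    have "\<alpha> (\<one>\<^bsub>H\<^esub>, g) \<in> {\<one>\<^bsub>H\<^esub>} \<times> carrier G"
      using ker g by blast
    then show "\<alpha> (\<one>\<^bsub>H\<^esub>, g) = (\<one>\<^bsub>H\<^esub>, \<pi> g)" "\<pi> g \<in> carrier G"
      using g by (auto simp: \<pi>_def)
  qed
  note [simp] = closed \<pi>_closed
  have shape: "\<alpha> (u, g) = (\<omega> u, d u \<otimes> \<pi> g)" if "u \<in> carrier H" "g \<in> carrier G" for u g
    using hom[of "(u, \<one>)" "(\<one>\<^bsub>H\<^esub>, g)"] that by (simp add: \<phi> \<psi> \<alpha>_u \<alpha>_g del: ext_mult)
  have surj: "\<exists>g\<in>carrier G. \<pi> g = y" if "y \<in> carrier G" for y
  proof -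
    have "(\<one>\<^bsub>H\<^esub>, y) \<in> \<alpha> ` ({\<one>\<^bsub>H\<^esub>} \<times> carrier G)"
      using ker that by simp
    then show ?thesis
      using \<alpha>_g by auto
  qed
  show "\<pi> \<in> carrier \<A>\<^sub>G"
  proof (rule G.autI)
    show "\<pi> (x \<otimes> y) = \<pi> x \<otimes> \<pi> y" if "x \<in> carrier G" "y \<in> carrier G" for x y
      using hom[of "(\<one>\<^bsub>H\<^esub>, x)" "(\<one>\<^bsub>H\<^esub>, y)"] that by (simp add: \<phi> \<psi> \<alpha>_g del: ext_mult)
    have "inj_on \<pi> (carrier G)"
    proof (rule inj_onI)
      fix x y assume xy: "x \<in> carrier G" "y \<in> carrier G" "\<pi> x = \<pi> y"
      then have "\<alpha> (\<one>\<^bsub>H\<^esub>, x) = \<alpha> (\<one>\<^bsub>H\<^esub>, y)"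
        by (simp add: \<alpha>_g)
      then show "x = y"
        using xy bij by (auto simp: bij_betw_def dest: inj_onD)
    qed
    then show "bij_betw \<pi> (carrier G) (carrier G)"
      using surj by (auto simp: bij_betw_def)
    show "\<pi> \<in> extensional (carrier G)"
      by (simp add: \<pi>_def)
  qed
  show "\<omega> \<in> carrier \<A>\<^sub>H"
  proof (rule H.autI)
    show "\<omega> (u \<otimes>\<^bsub>H\<^esub> v) = \<omega> u \<otimes>\<^bsub>H\<^esub> \<omega> v" if "u \<in> carrier H" "v \<in> carrier H" for u v
      using hom[of "(u, \<one>)" "(v, \<one>)"] that by (simp add: fs_closed[OF \<phi>] \<alpha>_u shape)
    have "inj_on \<omega> (carrier H)"
    proof (rule inj_onI)
      fix u v assume uv: "u \<in> carrier H" "v \<in> carrier H" "\<omega> u = \<omega> v"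
      \<comment> \<open>This g makes up for the difference of the second coordinates, so that equal
        values of \<omega> become equal values of the injective map \<alpha>.\<close>
      obtain g where g: "g \<in> carrier G" "\<pi> g = inv (d u) \<otimes> d v"
        using surj[of "inv (d u) \<otimes> d v"] uv by auto
      have "\<alpha> (u, g) = \<alpha> (v, \<one>)"
        using uv g by (simp add: shape G.aut_one[OF \<open>\<pi> \<in> carrier \<A>\<^sub>G\<close>])
      then show "u = v"
        using uv g bij by (auto simp: bij_betw_def dest: inj_onD)
    qed
    moreover have "k \<in> \<omega> ` carrier H" if k: "k \<in> carrier H" for k
    proof -
      have "(k, \<one>) \<in> \<alpha> ` (carrier H \<times> carrier G)"
        using bij k by (simp add: bij_betw_def)
      then show ?thesis
        using shape by auto
    qed
    ultimately show "bij_betw \<omega> (carrier H) (carrier H)"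
      by (auto simp: bij_betw_def)
    show "\<omega> \<in> extensional (carrier H)"
      by (simp add: \<omega>_def)
  qed
  show "\<alpha> (u, g) = (\<omega> u, snd (\<alpha> (u, \<one>)) \<otimes> \<pi> g)" if "u \<in> carrier H" "g \<in> carrier G" for u g
    using shape[OF that] by (simp add: d_def)
  show "snd (\<alpha> (u, \<one>)) \<in> carrier G" if "u \<in> carrier H" for u
    using closed(2)[OF that] by (simp add: d_def)
qed

text \<open>Multiplicativity of \<alpha> on (1, g) (u, 1) and on (u, 1) (v, 1). These are the
  conditions under which a function d defines an element of \<Gamma>, with the roles of the two
  extensions exchanged.\<close>

lemma G_iso_equations:
  assumes \<phi>: "fs \<phi>" and \<psi>: "fs \<psi>" and \<alpha>: "\<alpha> \<in> Isos \<phi> \<psi>" and pair: "induced_pair G H \<alpha> = (\<omega>, \<pi>)"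
  obtains d where "d \<in> carrier H \<rightarrow> carrier G" "d \<one>\<^bsub>H\<^esub> = \<one>"
    and "\<And>u g. u \<in> carrier H \<Longrightarrow> g \<in> carrier G \<Longrightarrow> \<alpha> (u, g) = (\<omega> u, d u \<otimes> \<pi> g)"
    and "\<And>u g. u \<in> carrier H \<Longrightarrow> g \<in> carrier G \<Longrightarrow> \<xi> (\<omega> u) (\<pi> g) \<otimes> d u = d u \<otimes> \<pi> (\<xi> u g)"
    and "\<And>u v. u \<in> carrier H \<Longrightarrow> v \<in> carrier H \<Longrightarrow>
      d (u \<otimes>\<^bsub>H\<^esub> v) \<otimes> \<pi> (\<phi> (u, v)) = \<psi> (\<omega> u, \<omega> v) \<otimes> \<xi> (\<omega> v) (d u) \<otimes> d v"
proof -
  define d where "d u = snd (\<alpha> (u, \<one>))" for u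
  note shape = G_iso_shape[OF assms]
  note [simp] = G.aut_simps[OF shape(2)] H.aut_simps[OF shape(1)] fs_simps[OF \<phi>] fs_simps[OF \<psi>]
  have closed [simp]: "d u \<in> carrier G" if "u \<in> carrier H" for u
    using that shape(4) by (simp add: d_def)
  have form: "\<alpha> (u, g) = (\<omega> u, d u \<otimes> \<pi> g)" if "u \<in> carrier H" "g \<in> carrier G" for u g
    using shape(3)[OF that] by (simp add: d_def)
  have hom: "\<alpha> (x \<otimes>\<^bsub>E \<phi>\<^esub> y) = \<alpha> x \<otimes>\<^bsub>E \<psi>\<^esub> \<alpha> y" if "x \<in> carrier (E \<phi>)" "y \<in> carrier (E \<phi>)" for x y
    using \<alpha> that by (auto simp: G_isos_def iso_def hom_def)
  have one: "d \<one>\<^bsub>H\<^esub> = \<one>"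
    using hom[of "(\<one>\<^bsub>H\<^esub>, \<one>)" "(\<one>\<^bsub>H\<^esub>, \<one>)"] by (simp add: form)
  have "\<xi> (\<omega> u) (\<pi> g) \<otimes> d u = d u \<otimes> \<pi> (\<xi> u g)" if "u \<in> carrier H" "g \<in> carrier G" for u g
    using hom[of "(\<one>\<^bsub>H\<^esub>, g)" "(u, \<one>)"] that by (simp add: form one)
  moreover have "d (u \<otimes>\<^bsub>H\<^esub> v) \<otimes> \<pi> (\<phi> (u, v)) = \<psi> (\<omega> u, \<omega> v) \<otimes> \<xi> (\<omega> v) (d u) \<otimes> d v"
    if "u \<in> carrier H" "v \<in> carrier H" for u v
    using hom[of "(u, \<one>)" "(v, \<one>)"] that by (simp add: form)
  ultimately show ?thesis
    using that[of d] one form by auto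
qed

lemma induced_pair_in_Comp:
  assumes \<phi>: "fs \<phi>" and \<psi>: "fs \<psi>" and \<alpha>: "\<alpha> \<in> Isos \<phi> \<psi>"
  shows "induced_pair G H \<alpha> \<in> carrier C"
proof -
  obtain \<omega> \<pi> where pair: "induced_pair G H \<alpha> = (\<omega>, \<pi>)"
    by fastforce
  note shape = G_iso_shape[OF assms pair]
  note [simp] = G.aut_simps[OF shape(2)] H.aut_simps[OF shape(1)]
  obtain d where d: "d \<in> carrier H \<rightarrow> carrier G"
    and eq: "\<And>u g. u \<in> carrier H \<Longrightarrow> g \<in> carrier G \<Longrightarrow> \<xi> (\<omega> u) (\<pi> g) \<otimes> d u = d u \<otimes> \<pi> (\<xi> u g)"
    using G_iso_equations[OF assms pair] by metis
  have "\<exists>t\<in>carrier G. \<forall>g\<in>carrier G. \<xi> (\<omega> u) (\<pi> g) = inv t \<otimes> \<pi> (\<xi> u g) \<otimes> t" if u: "u \<in> carrier H" for u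
  proof (intro bexI ballI)
    have [simp]: "d u \<in> carrier G"
      using d u by auto
    show "inv (d u) \<in> carrier G"
      by simp
    show "\<xi> (\<omega> u) (\<pi> g) = inv (inv (d u)) \<otimes> \<pi> (\<xi> u g) \<otimes> inv (d u)" if "g \<in> carrier G" for g
      using u that by (simp add: G.m_assoc flip: eq)
  qed
  then show ?thesis
    using shape(1,2) by (simp add: pair mem_Comp_iff)
qed

lemma G_iso_compose:
  assumes fs: "fs \<phi>" "fs \<psi>" "fs \<chi>" and \<alpha>: "\<alpha> \<in> Isos \<phi> \<psi>" and \<beta>: "\<beta> \<in> Isos \<psi> \<chi>"
  shows "\<beta> \<circ> \<alpha> \<in> Isos \<phi> \<chi>"
    and "induced_pair G H (\<beta> \<circ> \<alpha>) = induced_pair G H \<alpha> \<otimes>\<^bsub>C\<^esub> induced_pair G H \<beta>"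
proof -
  show "\<beta> \<circ> \<alpha> \<in> Isos \<phi> \<chi>"
    using \<alpha> \<beta> iso_set_trans by (auto simp: G_isos_def simp flip: image_image)
  obtain \<omega> \<pi> where pair: "induced_pair G H \<alpha> = (\<omega>, \<pi>)"
    by fastforce
  obtain \<omega>' \<pi>' where pair': "induced_pair G H \<beta> = (\<omega>', \<pi>')"
    by fastforce
  note shape = G_iso_shape[OF fs(1,2) \<alpha> pair] and shape' = G_iso_shape[OF fs(2,3) \<beta> pair']
  note [simp] = G.aut_simps[OF shape(2)] H.aut_simps[OF shape(1)] G.aut_simps[OF shape'(2)] H.aut_simps[OF shape'(1)]
  have \<pi>: "\<pi> g = snd (\<alpha> (\<one>\<^bsub>H\<^esub>, g))" "\<pi>' g = snd (\<beta> (\<one>\<^bsub>H\<^esub>, g))" if "g \<in> carrier G" for g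
    using pair pair' that by (auto simp: induced_pair_def)
  have "snd (\<beta> (\<alpha> (\<one>\<^bsub>H\<^esub>, g))) = \<pi>' (\<pi> g)" if g: "g \<in> carrier G" for g
  proof -
    have "\<alpha> (\<one>\<^bsub>H\<^esub>, g) = (\<one>\<^bsub>H\<^esub>, \<pi> g)"
      using shape(3)[of "\<one>\<^bsub>H\<^esub>" g] g \<pi>(1)[OF g] by (metis H.aut_one H.one_closed fst_conv prod.collapse shape(1))
    then show ?thesis
      using g by (simp add: \<pi>(2))
  qed
  moreover have "fst (\<beta> (\<alpha> (u, \<one>))) = \<omega>' (\<omega> u)" if u: "u \<in> carrier H" for u
    using shape(4)[OF u] u shape'(3)[of "\<omega> u" "snd (\<alpha> (u, \<one>))"] shape(3)[of u \<one>]
    by (metis G.one_closed G.aut_one G.r_one H.aut_closed fst_conv shape(1,2))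
  ultimately show "induced_pair G H (\<beta> \<circ> \<alpha>) = induced_pair G H \<alpha> \<otimes>\<^bsub>C\<^esub> induced_pair G H \<beta>"
    using shape(1,2) shape'(1,2) unfolding pair pair'
    by (simp add: induced_pair_def G.aut_grp_mult_eq H.aut_grp_mult_eq compose_def cong: restrict_cong)
qed

lemma G_iso_id:
  assumes "fs \<phi>"
  shows "id \<in> Isos \<phi> \<phi>" "induced_pair G H id = \<one>\<^bsub>C\<^esub>"
proof -
  show "id \<in> Isos \<phi> \<phi>"
    by (simp add: G_isos_def id_iso)
  show "induced_pair G H id = \<one>\<^bsub>C\<^esub>"
    by (simp add: induced_pair_def Comp_one aut_grp_def AutoGroup_def BijGroup_def)
qed

text \<open>The pair of the inverse is found from the composition law, without describing the
  inverse explicitly. \<open>inv_into\<close> undoes \<alpha> on the carrier only, and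
  \<open>induced_pair\<close> looks no further.\<close>

lemma G_iso_inv:
  assumes fs: "fs \<phi>" "fs \<psi>" and \<alpha>: "\<alpha> \<in> Isos \<phi> \<psi>"
  obtains \<beta> where "\<beta> \<in> Isos \<psi> \<phi>" "induced_pair G H \<beta> = inv\<^bsub>C\<^esub> (induced_pair G H \<alpha>)"
proof
  let ?\<beta> = "inv_into (carrier (E \<phi>)) \<alpha>"
  interpret E: group "E \<phi>"
    using fs(1) by (rule group_ext)
  have iso: "\<alpha> \<in> iso (E \<phi>) (E \<psi>)" and ker: "\<alpha> ` kernel_copy G H = kernel_copy G H"
    using \<alpha> by (auto simp: G_isos_def)
  have inj: "inj_on \<alpha> (carrier (E \<phi>))"
    using iso by (simp add: iso_def bij_betw_def)
  have sub: "kernel_copy G H \<subseteq> carrier (E \<phi>)"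
    by (auto simp: kernel_copy_def)
  have "?\<beta> ` kernel_copy G H = kernel_copy G H"
    using inv_into_image_cancel[OF inj sub] ker by simp
  then show \<beta>: "?\<beta> \<in> Isos \<psi> \<phi>"
    using E.iso_set_sym[OF iso] by (simp add: G_isos_def)
  have "?\<beta> (\<alpha> x) = x" if "x \<in> carrier (E \<phi>)" for x
    using inj that by (rule inv_into_f_f)
  then have "induced_pair G H (?\<beta> \<circ> \<alpha>) = induced_pair G H id"
    by (simp add: induced_pair_def cong: restrict_cong)
  then have "induced_pair G H \<alpha> \<otimes>\<^bsub>C\<^esub> induced_pair G H ?\<beta> = \<one>\<^bsub>C\<^esub>"
    using G_iso_compose(2)[OF fs fs(1) \<alpha> \<beta>] G_iso_id fs(1) by simp
  then show "induced_pair G H ?\<beta> = inv\<^bsub>C\<^esub> (induced_pair G H \<alpha>)"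
    using C.inv_equality C.inv_comm induced_pair_in_Comp \<alpha> \<beta> fs by metis
qed

end


section \<open>The function \<open>\<Gamma>\<close>\<close>

context coupling
begin

text \<open>The automorphism belonging to (h, 1) is \<xi>(h). Testing equality of automorphisms on
  the elements \<pi> g and clearing inverses gives the same equation as for a G-isomorphism. In use,
  \<omega> and \<pi> are the inverses of the components of a given pair.\<close>

lemma gamma_eq_T_act_iff:
  assumes \<phi>: "fs \<phi>" and \<omega>: "\<omega> \<in> carrier \<A>\<^sub>H" and \<pi>: "\<pi> \<in> carrier \<A>\<^sub>G"
    and h: "h \<in> carrier H" and a: "a \<in> carrier G"
  shows "gamma G H \<xi> \<phi> (\<omega> h, a) = T_act G (gamma G H \<xi> \<phi> (h, \<one>)) (\<omega>, \<pi>) \<longleftrightarrow>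
    (\<forall>g\<in>carrier G. \<xi> (\<omega> h) (\<pi> g) \<otimes> a = a \<otimes> \<pi> (\<xi> h g))"
proof -
  let ?\<pi>' = "inv\<^bsub>\<A>\<^sub>G\<^esub> \<pi>"
  note [simp] = G.aut_simps[OF \<pi>] G.aut_simps[OF AG.inv_closed[OF \<pi>]] H.aut_simps[OF \<omega>]
  \<comment> \<open>As an element of the automorphism group, \<open>\<xi> h\<close> is extensional,
    so restricting it to G leaves it unchanged.\<close>
  have "(\<lambda>g\<in>carrier G. inv \<one> \<otimes> \<xi> h g \<otimes> \<one>) = \<xi> h"
    using h xi_closed[OF h]
    by (auto simp: aut_grp_def AutoGroup_def auto_def Bij_def intro!: extensionalityI[of _ "carrier G"])
  then have \<gamma>: "gamma G H \<xi> \<phi> (h, \<one>) = (h, \<xi> h)"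
    using gamma_eq[OF \<phi> h G.one_closed] by simp
  have ac: "aut_conj G (\<xi> h) \<pi> = (\<lambda>g\<in>carrier G. \<pi> (\<xi> h (?\<pi>' g)))"
    using h \<pi> by (auto simp: aut_conj_def G.aut_grp_mult_eq[OF AG.m_closed] compose_def restrict_def fun_eq_iff)
  have "gamma G H \<xi> \<phi> (\<omega> h, a) = T_act G (gamma G H \<xi> \<phi> (h, \<one>)) (\<omega>, \<pi>) \<longleftrightarrow>
      (\<forall>g\<in>carrier G. inv a \<otimes> \<xi> (\<omega> h) g \<otimes> a = \<pi> (\<xi> h (?\<pi>' g)))"
    using h a by (simp add: gamma_eq[OF \<phi>] T_act_def \<gamma> ac) (auto simp: restrict_def fun_eq_iff)
  also have "\<dots> \<longleftrightarrow> (\<forall>g\<in>carrier G. inv a \<otimes> \<xi> (\<omega> h) (\<pi> g) \<otimes> a = \<pi> (\<xi> h g))"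
    by (metis G.aut_closed G.aut_grp_inv_apply \<pi> AG.inv_closed)
  also have "\<dots> \<longleftrightarrow> (\<forall>g\<in>carrier G. \<xi> (\<omega> h) (\<pi> g) \<otimes> a = a \<otimes> \<pi> (\<xi> h g))"
  proof (intro ball_cong refl)
    fix g assume g: "g \<in> carrier G"
    show "inv a \<otimes> \<xi> (\<omega> h) (\<pi> g) \<otimes> a = \<pi> (\<xi> h g) \<longleftrightarrow> \<xi> (\<omega> h) (\<pi> g) \<otimes> a = a \<otimes> \<pi> (\<xi> h g)"
      using G.inv_solve_left'[of "\<pi> (\<xi> h g)" a "\<xi> (\<omega> h) (\<pi> g) \<otimes> a"] g h a by (simp add: G.m_assoc)
  qed
  finally show ?thesis .
qed

lemma ext_div:
  assumes \<phi>: "fs \<phi>" and "u \<in> carrier H" "a \<in> carrier G" "b \<in> carrier G"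
  shows "inv\<^bsub>E \<phi>\<^esub> (u, a) \<otimes>\<^bsub>E \<phi>\<^esub> (u, b) = (\<one>\<^bsub>H\<^esub>, inv a \<otimes> b)"
proof -
  interpret E: group "E \<phi>"
    by (rule group_ext) fact
  have "(u, b) = (u, a) \<otimes>\<^bsub>E \<phi>\<^esub> (\<one>\<^bsub>H\<^esub>, inv a \<otimes> b)"
    using assms by (simp add: fs_simps[OF \<phi>])
  then show ?thesis
    using assms by (simp del: ext_mult kernel_mult)
qed

text \<open>A lift of h is a pair whose first coordinate is forced, so the family of lifts amounts
  to the function a of second coordinates. The condition on \<open>gamma\<close> and the formula for
  \<psi> become the equations of \<open>G_iso_equations\<close>, for a map from E(\<xi>, \<psi>) to
  E(\<xi>, \<phi>) with the inverse pair.\<close>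

lemma mem_Gamma_fs_iff:
  assumes \<phi>: "fs \<phi>" and x: "(\<omega>, \<pi>) \<in> carrier C"
  defines "\<omega>' \<equiv> inv\<^bsub>\<A>\<^sub>H\<^esub> \<omega>" and "\<pi>' \<equiv> inv\<^bsub>\<A>\<^sub>G\<^esub> \<pi>"
  shows "\<psi> \<in> Gamma_fs G H \<xi> (\<omega>, \<pi>) \<phi> \<longleftrightarrow> \<psi> \<in> carrier H \<times> carrier H \<rightarrow>\<^sub>E carrier G \<and>
    (\<exists>a \<in> carrier H \<rightarrow> carrier G. a \<one>\<^bsub>H\<^esub> = \<one> \<and>
      (\<forall>u\<in>carrier H. \<forall>g\<in>carrier G. \<xi> (\<omega>' u) (\<pi>' g) \<otimes> a u = a u \<otimes> \<pi>' (\<xi> u g)) \<and>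
      (\<forall>u\<in>carrier H. \<forall>v\<in>carrier H.
         a (u \<otimes>\<^bsub>H\<^esub> v) \<otimes> \<pi>' (\<psi> (u, v)) = \<phi> (\<omega>' u, \<omega>' v) \<otimes> \<xi> (\<omega>' v) (a u) \<otimes> a v))"
    (is "?L \<longleftrightarrow> ?R")
proof -
  have \<omega>: "\<omega> \<in> carrier \<A>\<^sub>H" and \<pi>: "\<pi> \<in> carrier \<A>\<^sub>G"
    using x by (simp_all add: mem_Comp_iff)
  have \<omega>': "\<omega>' \<in> carrier \<A>\<^sub>H" and \<pi>': "\<pi>' \<in> carrier \<A>\<^sub>G"
    using \<omega> \<pi> by (simp_all add: \<omega>'_def \<pi>'_def)
  have \<pi>\<pi>' [simp]: "\<pi> (\<pi>' g) = g" "\<pi>' (\<pi> g) = g" if "g \<in> carrier G" for g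
    using that \<pi> by (simp_all add: \<pi>'_def G.aut_grp_inv_apply)
  note [simp] = G.aut_simps[OF \<pi>] H.aut_simps[OF \<omega>] G.aut_simps[OF \<pi>'] H.aut_simps[OF \<omega>'] fs_simps[OF \<phi>]
  interpret E: group "E \<phi>"
    by (rule group_ext) fact
  let ?c = "\<lambda>a u v. inv (a (u \<otimes>\<^bsub>H\<^esub> v)) \<otimes> (\<phi> (\<omega>' u, \<omega>' v) \<otimes> \<xi> (\<omega>' v) (a u) \<otimes> a v)"
  let ?t = "\<lambda>a u. (\<omega>' u, a u)"
  have prod: "inv\<^bsub>E \<phi>\<^esub> (?t a (u \<otimes>\<^bsub>H\<^esub> v)) \<otimes>\<^bsub>E \<phi>\<^esub> ?t a u \<otimes>\<^bsub>E \<phi>\<^esub> ?t a v = (\<one>\<^bsub>H\<^esub>, ?c a u v)"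
    if a: "a \<in> carrier H \<rightarrow> carrier G" and "u \<in> carrier H" "v \<in> carrier H" for a u v
  proof -
    have [simp]: "a w \<in> carrier G" if "w \<in> carrier H" for w
      using a that by auto
    show ?thesis
      using that E.inv_closed[of "?t a (u \<otimes>\<^bsub>H\<^esub> v)"] by (simp add: E.m_assoc del: kernel_mult) (simp add: ext_div[OF \<phi>])
  qed
  have c_iff: "a (u \<otimes>\<^bsub>H\<^esub> v) \<otimes> \<pi>' y = \<phi> (\<omega>' u, \<omega>' v) \<otimes> \<xi> (\<omega>' v) (a u) \<otimes> a v \<longleftrightarrow> y = \<pi> (?c a u v)"
    if a: "a \<in> carrier H \<rightarrow> carrier G" and "u \<in> carrier H" "v \<in> carrier H" and y: "y \<in> carrier G" for a u v y
  proof -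
    have [simp]: "a w \<in> carrier G" if "w \<in> carrier H" for w
      using a that by auto
    have "a (u \<otimes>\<^bsub>H\<^esub> v) \<otimes> \<pi>' y = \<phi> (\<omega>' u, \<omega>' v) \<otimes> \<xi> (\<omega>' v) (a u) \<otimes> a v \<longleftrightarrow> \<pi>' y = ?c a u v"
      using that G.inv_solve_left[of "\<pi>' y" "a (u \<otimes>\<^bsub>H\<^esub> v)"] by (auto simp del: G.inv_l_cancel)
    also have "\<dots> \<longleftrightarrow> y = \<pi> (?c a u v)"
    proof
      assume "\<pi>' y = ?c a u v"
      then have "\<pi> (\<pi>' y) = \<pi> (?c a u v)"
        by (rule arg_cong)
      then show "y = \<pi> (?c a u v)"
        using y by (simp only: \<pi>\<pi>')
    next
      \<comment> \<open>Here \<pi> must not be distributed over the product \<open>?c a u v\<close>;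
        only then does it meet its inverse.\<close>
      assume "y = \<pi> (?c a u v)"
      then show "\<pi>' y = ?c a u v"
        using that by (simp only: \<pi>\<pi>' fs_closed[OF \<phi>] G.m_closed G.inv_closed H.m_closed xi_simps \<open>\<And>w. w \<in> carrier H \<Longrightarrow> a w \<in> carrier G\<close> H.aut_closed[OF \<omega>'])
    qed
    finally show ?thesis .
  qed
  show ?thesis
  proof
    assume ?L
    then obtain t where t: "t \<in> carrier H \<rightarrow> carrier (E \<phi>)" "t \<one>\<^bsub>H\<^esub> = \<one>\<^bsub>E \<phi>\<^esub>"
      and gam: "\<And>h. h \<in> carrier H \<Longrightarrow> gamma G H \<xi> \<phi> (t h) = T_act G (gamma G H \<xi> \<phi> (h, \<one>)) (\<omega>', \<pi>')"
      and \<psi>: "\<psi> = (\<lambda>(h, k)\<in>carrier H \<times> carrier H.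
        \<pi> (snd (inv\<^bsub>E \<phi>\<^esub> (t (h \<otimes>\<^bsub>H\<^esub> k)) \<otimes>\<^bsub>E \<phi>\<^esub> t h \<otimes>\<^bsub>E \<phi>\<^esub> t k)))"
      unfolding Gamma_fs_def Let_def \<omega>'_def \<pi>'_def by auto
    define a where "a = snd \<circ> t"
    have a: "a \<in> carrier H \<rightarrow> carrier G"
      using t by (auto simp: a_def Pi_iff mem_Times_iff)
    then have [simp]: "a w \<in> carrier G" if "w \<in> carrier H" for w
      using that by auto
    \<comment> \<open>The first component of \<open>gamma\<close> is the projection to H, which
      fixes the first coordinate of the lift.\<close>
    have t_eq: "t h = (\<omega>' h, a h)" if h: "h \<in> carrier H" for h
      using gam[OF h] h by (auto simp: gamma_def T_act_def a_def prod_eq_iff)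
    have cond: "\<forall>g\<in>carrier G. \<xi> (\<omega>' u) (\<pi>' g) \<otimes> a u = a u \<otimes> \<pi>' (\<xi> u g)" if u: "u \<in> carrier H" for u
      using gam[OF u] gamma_eq_T_act_iff[OF \<phi> \<omega>' \<pi>' u] u by (simp add: t_eq)
    have \<psi>_eq: "\<psi> = (\<lambda>(u, v)\<in>carrier H \<times> carrier H. \<pi> (?c a u v))"
      unfolding \<psi> by (rule restrict_ext) (auto simp only: t_eq prod[OF a] snd_conv H.m_closed)
    then have "\<psi> \<in> carrier H \<times> carrier H \<rightarrow>\<^sub>E carrier G"
      by auto
    moreover have "a (u \<otimes>\<^bsub>H\<^esub> v) \<otimes> \<pi>' (\<psi> (u, v)) = \<phi> (\<omega>' u, \<omega>' v) \<otimes> \<xi> (\<omega>' v) (a u) \<otimes> a v"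
      if "u \<in> carrier H" "v \<in> carrier H" for u v
      using that by (subst c_iff[OF a]) (simp_all add: \<psi>_eq)
    moreover have "a \<one>\<^bsub>H\<^esub> = \<one>"
      using t by (simp add: a_def)
    ultimately show ?R
      using a cond by blast
  next
    assume ?R
    then obtain a where \<psi>: "\<psi> \<in> carrier H \<times> carrier H \<rightarrow>\<^sub>E carrier G" and a: "a \<in> carrier H \<rightarrow> carrier G"
      and a1: "a \<one>\<^bsub>H\<^esub> = \<one>"
      and cond: "\<forall>u\<in>carrier H. \<forall>g\<in>carrier G. \<xi> (\<omega>' u) (\<pi>' g) \<otimes> a u = a u \<otimes> \<pi>' (\<xi> u g)"
      and eq: "\<And>u v. u \<in> carrier H \<Longrightarrow> v \<in> carrier H \<Longrightarrow>
        a (u \<otimes>\<^bsub>H\<^esub> v) \<otimes> \<pi>' (\<psi> (u, v)) = \<phi> (\<omega>' u, \<omega>' v) \<otimes> \<xi> (\<omega>' v) (a u) \<otimes> a v"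
      by blast
    have [simp]: "a w \<in> carrier G" if "w \<in> carrier H" for w
      using a that by auto
    have \<psi>_eq: "\<psi> (u, v) = \<pi> (?c a u v)" if "u \<in> carrier H" "v \<in> carrier H" for u v
      using eq[OF that] c_iff[OF a that, of "\<psi> (u, v)"] \<psi> that by auto
    have "\<psi> = (\<lambda>(h, k)\<in>carrier H \<times> carrier H.
        \<pi> (snd (inv\<^bsub>E \<phi>\<^esub> (?t a (h \<otimes>\<^bsub>H\<^esub> k)) \<otimes>\<^bsub>E \<phi>\<^esub> ?t a h \<otimes>\<^bsub>E \<phi>\<^esub> ?t a k)))"
    proof (rule extensionalityI[of _ "carrier H \<times> carrier H"])
      show "\<psi> \<in> extensional (carrier H \<times> carrier H)"
        using \<psi> by (simp add: PiE_def)
      show "\<psi> p = (\<lambda>(h, k)\<in>carrier H \<times> carrier H.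
          \<pi> (snd (inv\<^bsub>E \<phi>\<^esub> (?t a (h \<otimes>\<^bsub>H\<^esub> k)) \<otimes>\<^bsub>E \<phi>\<^esub> ?t a h \<otimes>\<^bsub>E \<phi>\<^esub> ?t a k))) p"
        if p: "p \<in> carrier H \<times> carrier H" for p
      proof -
        obtain u v where "p = (u, v)" "u \<in> carrier H" "v \<in> carrier H"
          using p by auto
        then show ?thesis
          by (simp only: restrict_apply mem_Times_iff fst_conv snd_conv simp_thms if_True prod.case \<psi>_eq prod[OF a])
      qed
    qed simp
    moreover have "gamma G H \<xi> \<phi> (?t a h) = T_act G (gamma G H \<xi> \<phi> (h, \<one>)) (\<omega>', \<pi>')"
      if h: "h \<in> carrier H" for h
      using gamma_eq_T_act_iff[OF \<phi> \<omega>' \<pi>' h, of "a h"] cond h by simp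
    moreover have "?t a \<in> carrier H \<rightarrow> carrier (E \<phi>)" "?t a \<one>\<^bsub>H\<^esub> = \<one>\<^bsub>E \<phi>\<^esub>"
      by (auto simp: a1)
    ultimately show ?L
      unfolding Gamma_fs_def Let_def prod.case \<omega>'_def[symmetric] \<pi>'_def[symmetric]
      by (intro CollectI exI[of _ "?t a"] conjI ballI)
  qed
qed

text \<open>The lifts and a G-isomorphism carry the same data. Once this is known, \<Gamma> is a
  relation between factor sets that inherits identity, inverses and composition from the
  isomorphisms.\<close>

lemma Gamma_fs_eq:
  assumes \<phi>: "fs \<phi>" and x: "x \<in> carrier C"
  shows "Gamma_fs G H \<xi> x \<phi> = {\<psi>. fs \<psi> \<and> (\<exists>\<alpha>\<in>Isos \<phi> \<psi>. induced_pair G H \<alpha> = x)}"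
proof -
  obtain \<omega> \<pi> where x_eq: "x = (\<omega>, \<pi>)"
    by fastforce
  have \<omega>: "\<omega> \<in> carrier \<A>\<^sub>H" and \<pi>: "\<pi> \<in> carrier \<A>\<^sub>G"
    using x by (simp_all add: x_eq mem_Comp_iff)
  define \<omega>' where "\<omega>' = inv\<^bsub>\<A>\<^sub>H\<^esub> \<omega>"
  define \<pi>' where "\<pi>' = inv\<^bsub>\<A>\<^sub>G\<^esub> \<pi>"
  have \<omega>': "\<omega>' \<in> carrier \<A>\<^sub>H" and \<pi>': "\<pi>' \<in> carrier \<A>\<^sub>G"
    using \<omega> \<pi> by (simp_all add: \<omega>'_def \<pi>'_def)
  note iff = mem_Gamma_fs_iff[OF \<phi> x[unfolded x_eq], folded \<omega>'_def \<pi>'_def]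
  have inv_x: "inv\<^bsub>C\<^esub> x = (\<omega>', \<pi>')"
    using x by (simp add: x_eq Comp_inv \<omega>'_def \<pi>'_def)
  note [simp] = G.aut_simps[OF \<pi>'] H.aut_simps[OF \<omega>'] fs_simps[OF \<phi>]
  show ?thesis
  proof (intro equalityI subsetI CollectI conjI)
    fix \<psi> assume "\<psi> \<in> Gamma_fs G H \<xi> x \<phi>"
    then obtain a where \<psi>: "\<psi> \<in> carrier H \<times> carrier H \<rightarrow>\<^sub>E carrier G" and a: "a \<in> carrier H \<rightarrow> carrier G"
      and a1: "a \<one>\<^bsub>H\<^esub> = \<one>"
      and cond: "\<And>u g. u \<in> carrier H \<Longrightarrow> g \<in> carrier G \<Longrightarrow> \<xi> (\<omega>' u) (\<pi>' g) \<otimes> a u = a u \<otimes> \<pi>' (\<xi> u g)"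
      and eq: "\<And>u v. u \<in> carrier H \<Longrightarrow> v \<in> carrier H \<Longrightarrow>
        a (u \<otimes>\<^bsub>H\<^esub> v) \<otimes> \<pi>' (\<psi> (u, v)) = \<phi> (\<omega>' u, \<omega>' v) \<otimes> \<xi> (\<omega>' v) (a u) \<otimes> a v"
      unfolding x_eq iff by blast
    have [simp]: "a w \<in> carrier G" if "w \<in> carrier H" for w
      using a that by auto
    have \<psi>_closed [simp]: "\<psi> (u, v) \<in> carrier G" if "u \<in> carrier H" "v \<in> carrier H" for u v
      using \<psi> that by auto
    \<comment> \<open>The value is the lift of u times the image of g under \<open>\<pi>'\<close>.
      Both lie in E(\<xi>, \<phi>), which is why \<beta> runs opposite to the isomorphism
      sought.\<close>
    define \<beta> where "\<beta> = (\<lambda>(u, g). (\<omega>' u, a u \<otimes> \<pi>' g))"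
    have hom: "\<beta> (p \<otimes>\<^bsub>E \<psi>\<^esub> q) = \<beta> p \<otimes>\<^bsub>E \<phi>\<^esub> \<beta> q"
      if pq: "p \<in> carrier (E \<psi>)" "q \<in> carrier (E \<psi>)" for p q
    proof -
      obtain u g v k where p: "p = (u, g)" "u \<in> carrier H" "g \<in> carrier G"
        and q: "q = (v, k)" "v \<in> carrier H" "k \<in> carrier G"
        using pq by auto
      have "a (u \<otimes>\<^bsub>H\<^esub> v) \<otimes> \<pi>' (\<psi> (u, v) \<otimes> \<xi> v g \<otimes> k) =
          (a (u \<otimes>\<^bsub>H\<^esub> v) \<otimes> \<pi>' (\<psi> (u, v))) \<otimes> (\<pi>' (\<xi> v g) \<otimes> \<pi>' k)"
        using p q by (simp add: G.m_assoc)
      also have "\<dots> = \<phi> (\<omega>' u, \<omega>' v) \<otimes> \<xi> (\<omega>' v) (a u) \<otimes> (a v \<otimes> \<pi>' (\<xi> v g)) \<otimes> \<pi>' k"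
        using p q by (simp only: eq) (simp add: G.m_assoc)
      also have "\<dots> = \<phi> (\<omega>' u, \<omega>' v) \<otimes> \<xi> (\<omega>' v) (a u \<otimes> \<pi>' g) \<otimes> (a v \<otimes> \<pi>' k)"
        using p q by (simp only: cond[symmetric]) (simp add: G.m_assoc)
      finally show ?thesis
        using p q by (simp add: \<beta>_def)
    qed
    have bij: "bij_betw \<beta> (carrier (E \<psi>)) (carrier (E \<phi>))"
    proof (rule bij_betwI')
      show "\<beta> p \<in> carrier (E \<phi>)" if "p \<in> carrier (E \<psi>)" for p
        using that by (auto simp: \<beta>_def)
      show "\<beta> p = \<beta> q \<longleftrightarrow> p = q" if pq: "p \<in> carrier (E \<psi>)" "q \<in> carrier (E \<psi>)" for p q
      proof
        assume eq: "\<beta> p = \<beta> q"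
        obtain u g v k where p: "p = (u, g)" "u \<in> carrier H" "g \<in> carrier G"
          and q: "q = (v, k)" "v \<in> carrier H" "k \<in> carrier G"
          using pq by auto
        have "u = v"
          using eq p q H.aut_bij[OF \<omega>'] by (auto simp: \<beta>_def bij_betw_def dest: inj_onD)
        moreover have "g = k"
          using eq p q G.aut_bij[OF \<pi>'] \<open>u = v\<close> by (auto simp: \<beta>_def bij_betw_def dest: inj_onD)
        ultimately show "p = q"
          using p q by simp
      qed simp
      show "\<exists>p\<in>carrier (E \<psi>). q = \<beta> p" if q: "q \<in> carrier (E \<phi>)" for q
      proof -
        obtain v k where vk: "q = (v, k)" "v \<in> carrier H" "k \<in> carrier G"
          using q by auto
        obtain u where u: "u \<in> carrier H" "\<omega>' u = v"
          using H.aut_bij[OF \<omega>'] vk(2) by (metis bij_betw_def imageE)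
        obtain g where g: "g \<in> carrier G" "\<pi>' g = inv (a u) \<otimes> k"
          using G.aut_bij[OF \<pi>'] vk u by (metis G.inv_closed G.m_closed \<open>\<And>w. w \<in> carrier H \<Longrightarrow> a w \<in> carrier G\<close> bij_betw_def imageE)
        show ?thesis
          by (rule bexI[of _ "(u, g)"]) (use u g vk in \<open>auto simp: \<beta>_def\<close>)
      qed
    qed
    have closed: "p \<otimes>\<^bsub>E \<psi>\<^esub> q \<in> carrier (E \<psi>)" if "p \<in> carrier (E \<psi>)" "q \<in> carrier (E \<psi>)" for p q
      using that by auto
    interpret E: group "E \<phi>"
      by (rule group_ext) fact
    show fs: "fs \<psi>"
    proof (rule factor_setI)
      show "\<psi> \<in> carrier H \<times> carrier H \<rightarrow>\<^sub>E carrier G"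
        by fact
      \<comment> \<open>The value of \<psi> at a pair containing 1 is mapped to 1 by
        \<open>\<pi>'\<close>: in \<open>eq\<close>, both a and \<phi> are normalized, and the
        remaining factor cancels.\<close>
      have \<pi>'_one: "y = \<one>" if "y \<in> carrier G" "\<pi>' y = \<one>" for y
        using that G.aut_bij[OF \<pi>'] by (metis G.aut_one G.one_closed \<pi>' bij_betw_def inj_onD)
      show "\<psi> (h, \<one>\<^bsub>H\<^esub>) = \<one>" if h: "h \<in> carrier H" for h
        by (rule \<pi>'_one) (use eq[of h "\<one>\<^bsub>H\<^esub>"] h in \<open>simp_all add: a1\<close>)
      show "\<psi> (\<one>\<^bsub>H\<^esub>, h) = \<one>" if h: "h \<in> carrier H" for h
        by (rule \<pi>'_one) (use eq[of "\<one>\<^bsub>H\<^esub>" h] h in \<open>simp_all add: a1\<close>)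
      \<comment> \<open>Only the target is known to be a group here. The two bracketings have the
        same image under \<beta>, and injectivity makes them equal.\<close>
      fix p q r assume pqr: "p \<in> carrier (E \<psi>)" "q \<in> carrier (E \<psi>)" "r \<in> carrier (E \<psi>)"
      have "\<beta> (p \<otimes>\<^bsub>E \<psi>\<^esub> q \<otimes>\<^bsub>E \<psi>\<^esub> r) = \<beta> (p \<otimes>\<^bsub>E \<psi>\<^esub> (q \<otimes>\<^bsub>E \<psi>\<^esub> r))"
        using pqr bij_betwE[OF bij] by (simp only: hom closed) (simp only: E.m_assoc)
      then show "p \<otimes>\<^bsub>E \<psi>\<^esub> q \<otimes>\<^bsub>E \<psi>\<^esub> r = p \<otimes>\<^bsub>E \<psi>\<^esub> (q \<otimes>\<^bsub>E \<psi>\<^esub> r)"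
        using bij pqr closed by (meson bij_betw_def inj_onD)
    qed
    have "\<beta> ` kernel_copy G H = Pair \<one>\<^bsub>H\<^esub> ` \<pi>' ` carrier G"
      by (force simp: \<beta>_def kernel_copy_def a1)
    then have ker: "\<beta> ` kernel_copy G H = kernel_copy G H"
      using G.aut_bij[OF \<pi>'] by (auto simp: kernel_copy_def bij_betw_def)
    have "\<beta> \<in> hom (E \<psi>) (E \<phi>)"
      using hom bij_betwE[OF bij] by (auto simp: hom_def)
    then have \<beta>: "\<beta> \<in> Isos \<psi> \<phi>"
      using bij ker by (simp add: G_isos_def iso_def)
    have "induced_pair G H \<beta> = (\<omega>', \<pi>')"
      using \<omega>' \<pi>' by (auto simp: induced_pair_def \<beta>_def a1 aut_grp_def AutoGroup_def auto_def Bij_def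
          cong: restrict_cong intro: extensional_restrict)
    then show "\<exists>\<alpha>\<in>Isos \<phi> \<psi>. induced_pair G H \<alpha> = x"
      using G_iso_inv[OF fs \<phi> \<beta>] x by (metis C.inv_inv inv_x)
  next
    fix \<psi> assume "\<psi> \<in> {\<psi>. fs \<psi> \<and> (\<exists>\<alpha>\<in>Isos \<phi> \<psi>. induced_pair G H \<alpha> = x)}"
    then obtain \<alpha> where \<psi>: "fs \<psi>" and \<alpha>: "\<alpha> \<in> Isos \<phi> \<psi>" "induced_pair G H \<alpha> = x"
      by blast
    \<comment> \<open>The criterion for \<Gamma> describes a map into E(\<xi>, \<phi>), so \<alpha>
      is inverted before its equations are read off.\<close>
    obtain \<beta> where \<beta>: "\<beta> \<in> Isos \<psi> \<phi>" "induced_pair G H \<beta> = (\<omega>', \<pi>')"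
      using G_iso_inv[OF \<phi> \<psi> \<alpha>(1)] by (metis \<alpha>(2) inv_x)
    obtain d where "d \<in> carrier H \<rightarrow> carrier G" "d \<one>\<^bsub>H\<^esub> = \<one>"
      and "\<And>u g. u \<in> carrier H \<Longrightarrow> g \<in> carrier G \<Longrightarrow> \<xi> (\<omega>' u) (\<pi>' g) \<otimes> d u = d u \<otimes> \<pi>' (\<xi> u g)"
      and "\<And>u v. u \<in> carrier H \<Longrightarrow> v \<in> carrier H \<Longrightarrow>
        d (u \<otimes>\<^bsub>H\<^esub> v) \<otimes> \<pi>' (\<psi> (u, v)) = \<phi> (\<omega>' u, \<omega>' v) \<otimes> \<xi> (\<omega>' v) (d u) \<otimes> d v"
      using G_iso_equations[OF \<psi> \<phi> \<beta>] by metis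
    then show "\<psi> \<in> Gamma_fs G H \<xi> x \<phi>"
      unfolding x_eq iff using fs_funcset[OF \<psi>] by blast
  qed
qed

text \<open>Compatibility of the inverse pair provides, for each u, an element by which the two
  automorphisms to be matched differ. It supplies the second coordinate of a lift, and \<psi> is
  then obtained by solving the product equation.\<close>

lemma Gamma_fs_nonempty:
  assumes \<phi>: "fs \<phi>" and x: "x \<in> carrier C"
  shows "Gamma_fs G H \<xi> x \<phi> \<noteq> {}"
proof -
  obtain \<omega> \<pi> where x_eq: "x = (\<omega>, \<pi>)"
    by fastforce
  have \<omega>: "\<omega> \<in> carrier \<A>\<^sub>H" and \<pi>: "\<pi> \<in> carrier \<A>\<^sub>G"
    using x by (simp_all add: x_eq mem_Comp_iff)
  define \<omega>' where "\<omega>' = inv\<^bsub>\<A>\<^sub>H\<^esub> \<omega>"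
  define \<pi>' where "\<pi>' = inv\<^bsub>\<A>\<^sub>G\<^esub> \<pi>"
  have \<omega>': "\<omega>' \<in> carrier \<A>\<^sub>H" and \<pi>': "\<pi>' \<in> carrier \<A>\<^sub>G"
    using \<omega> \<pi> by (simp_all add: \<omega>'_def \<pi>'_def)
  note [simp] = G.aut_simps[OF \<pi>] G.aut_simps[OF \<pi>'] H.aut_simps[OF \<omega>'] fs_simps[OF \<phi>]
  have [simp]: "\<pi>' (\<pi> g) = g" if "g \<in> carrier G" for g
    using that \<pi> by (simp add: \<pi>'_def G.aut_grp_inv_apply)
  have "(\<omega>', \<pi>') \<in> carrier C"
    using C.inv_closed[OF x] x by (simp add: x_eq Comp_inv \<omega>'_def \<pi>'_def)
  then have "\<forall>u\<in>carrier H. \<exists>t\<in>carrier G. \<forall>g\<in>carrier G. \<xi> (\<omega>' u) (\<pi>' g) = inv t \<otimes> \<pi>' (\<xi> u g) \<otimes> t"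
    by (simp add: mem_Comp_iff)
  then obtain t where t [simp]: "\<And>u. u \<in> carrier H \<Longrightarrow> t u \<in> carrier G"
    and t_eq: "\<And>u g. u \<in> carrier H \<Longrightarrow> g \<in> carrier G \<Longrightarrow> \<xi> (\<omega>' u) (\<pi>' g) = inv (t u) \<otimes> \<pi>' (\<xi> u g) \<otimes> t u"
    by metis
  \<comment> \<open>The choice of t is arbitrary at 1, so the value there is reset to 1. This is
    harmless: \<xi>(1) is the identity, and both sides of the equation at u = 1 are the image of g
    under \<open>\<pi>'\<close>.\<close>
  define a where "a u = (if u = \<one>\<^bsub>H\<^esub> then \<one> else inv (t u))" for u
  have a [simp]: "a u \<in> carrier G" if "u \<in> carrier H" for u
    using that by (simp add: a_def)
  have a1: "a \<one>\<^bsub>H\<^esub> = \<one>"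
    by (simp add: a_def)
  have cond: "\<xi> (\<omega>' u) (\<pi>' g) \<otimes> a u = a u \<otimes> \<pi>' (\<xi> u g)" if "u \<in> carrier H" "g \<in> carrier G" for u g
    by (cases "u = \<one>\<^bsub>H\<^esub>") (use that in \<open>simp_all add: a_def t_eq G.m_assoc\<close>)
  define \<psi> where "\<psi> = (\<lambda>(u, v)\<in>carrier H \<times> carrier H.
    \<pi> (inv (a (u \<otimes>\<^bsub>H\<^esub> v)) \<otimes> (\<phi> (\<omega>' u, \<omega>' v) \<otimes> \<xi> (\<omega>' v) (a u) \<otimes> a v)))"
  have "a (u \<otimes>\<^bsub>H\<^esub> v) \<otimes> \<pi>' (\<psi> (u, v)) = \<phi> (\<omega>' u, \<omega>' v) \<otimes> \<xi> (\<omega>' v) (a u) \<otimes> a v"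
    if "u \<in> carrier H" "v \<in> carrier H" for u v
    using that by (simp add: \<psi>_def del: G.aut_mult[OF \<pi>])
  moreover have "\<psi> \<in> carrier H \<times> carrier H \<rightarrow>\<^sub>E carrier G"
    by (auto simp: \<psi>_def)
  moreover have "a \<in> carrier H \<rightarrow> carrier G"
    by simp
  ultimately have "\<psi> \<in> Gamma_fs G H \<xi> x \<phi>"
    unfolding x_eq mem_Gamma_fs_iff[OF \<phi> x[unfolded x_eq], folded \<omega>'_def \<pi>'_def] using cond a1 by blast
  then show ?thesis
    by blast
qed

text \<open>Composing isomorphisms gives one inclusion. For the other, an arbitrary \<psi> in
  \<Gamma>(x) serves as intermediate factor set: going back from \<psi> to \<phi> and on to \<chi>
  induces the pair inv x (x y) = y.\<close>

lemma Gamma_fs_mult: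
  assumes \<phi>: "fs \<phi>" and x: "x \<in> carrier C" and y: "y \<in> carrier C"
  shows "(\<Union>\<psi>\<in>Gamma_fs G H \<xi> x \<phi>. Gamma_fs G H \<xi> y \<psi>) = Gamma_fs G H \<xi> (x \<otimes>\<^bsub>C\<^esub> y) \<phi>"
proof (intro equalityI subsetI)
  fix \<chi> assume "\<chi> \<in> (\<Union>\<psi>\<in>Gamma_fs G H \<xi> x \<phi>. Gamma_fs G H \<xi> y \<psi>)"
  then obtain \<psi> \<alpha> \<beta> where "fs \<psi>" "fs \<chi>" "\<alpha> \<in> Isos \<phi> \<psi>" "\<beta> \<in> Isos \<psi> \<chi>"
    "induced_pair G H \<alpha> = x" "induced_pair G H \<beta> = y"
    using Gamma_fs_eq x y \<phi> by auto
  then show "\<chi> \<in> Gamma_fs G H \<xi> (x \<otimes>\<^bsub>C\<^esub> y) \<phi>"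
    using G_iso_compose[OF \<phi>, of \<psi> \<chi> \<alpha> \<beta>] x y by (auto simp: Gamma_fs_eq[OF \<phi>])
next
  fix \<chi> assume "\<chi> \<in> Gamma_fs G H \<xi> (x \<otimes>\<^bsub>C\<^esub> y) \<phi>"
  then obtain \<alpha> where \<chi>: "fs \<chi>" and \<alpha>: "\<alpha> \<in> Isos \<phi> \<chi>" "induced_pair G H \<alpha> = x \<otimes>\<^bsub>C\<^esub> y"
    using x y by (auto simp: Gamma_fs_eq[OF \<phi>])
  obtain \<psi> where \<psi>_mem: "\<psi> \<in> Gamma_fs G H \<xi> x \<phi>"
    using Gamma_fs_nonempty[OF \<phi> x] by blast
  then obtain \<beta> where \<psi>: "fs \<psi>" and \<beta>: "\<beta> \<in> Isos \<phi> \<psi>" "induced_pair G H \<beta> = x"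
    using x by (auto simp: Gamma_fs_eq[OF \<phi>])
  obtain \<beta>' where \<beta>': "\<beta>' \<in> Isos \<psi> \<phi>" "induced_pair G H \<beta>' = inv\<^bsub>C\<^esub> x"
    using G_iso_inv[OF \<phi> \<psi> \<beta>(1)] \<beta>(2) by metis
  have "induced_pair G H (\<alpha> \<circ> \<beta>') = y"
    using G_iso_compose(2)[OF \<psi> \<phi> \<chi> \<beta>'(1) \<alpha>(1)] x y by (simp add: \<alpha>(2) \<beta>'(2))
  then have "\<chi> \<in> Gamma_fs G H \<xi> y \<psi>"
    using G_iso_compose(1)[OF \<psi> \<phi> \<chi> \<beta>'(1) \<alpha>(1)] \<chi> by (auto simp: Gamma_fs_eq[OF \<psi> y])
  then show "\<chi> \<in> (\<Union>\<psi>\<in>Gamma_fs G H \<xi> x \<phi>. Gamma_fs G H \<xi> y \<psi>)"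
    using \<psi>_mem by blast
qed

lemma Gamma_fs_fs: "fs \<phi> \<Longrightarrow> x \<in> carrier C \<Longrightarrow> \<psi> \<in> Gamma_fs G H \<xi> x \<phi> \<Longrightarrow> fs \<psi>"
  by (simp add: Gamma_fs_eq)

lemma Gamma_fs_sym:
  assumes "fs \<phi>" "x \<in> carrier C" "\<psi> \<in> Gamma_fs G H \<xi> x \<phi>"
  shows "\<phi> \<in> Gamma_fs G H \<xi> (inv\<^bsub>C\<^esub> x) \<psi>"
proof -
  obtain \<alpha> where "fs \<psi>" "\<alpha> \<in> Isos \<phi> \<psi>" "induced_pair G H \<alpha> = x"
    using assms by (auto simp: Gamma_fs_eq)
  then show ?thesis
    using assms G_iso_inv[of \<phi> \<psi> \<alpha>] by (auto simp: Gamma_fs_eq)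
qed

text \<open>Any two members of \<Gamma>(x) are joined, through \<phi>, by an isomorphism inducing
  the trivial pair. As \<Gamma>(1) adds coboundaries, this makes the value of \<Gamma>(x) a single
  coset of \<open>B2\<close>.\<close>

lemma Gamma_fs_eq_coset:
  assumes \<phi>: "fs \<phi>" and x: "x \<in> carrier C" and \<psi>: "\<psi> \<in> Gamma_fs G H \<xi> x \<phi>"
  shows "Gamma_fs G H \<xi> x \<phi> = Gamma_fs G H \<xi> \<one>\<^bsub>C\<^esub> \<psi>"
proof -
  have fs: "fs \<psi>"
    using Gamma_fs_fs assms by blast
  have "Gamma_fs G H \<xi> \<one>\<^bsub>C\<^esub> \<psi> \<subseteq> Gamma_fs G H \<xi> x \<phi>"
    using Gamma_fs_mult[OF \<phi> x C.one_closed] \<psi> x by auto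
  moreover have "Gamma_fs G H \<xi> x \<phi> \<subseteq> Gamma_fs G H \<xi> \<one>\<^bsub>C\<^esub> \<psi>"
    using Gamma_fs_mult[OF fs C.inv_closed[OF x] x] Gamma_fs_sym[OF \<phi> x \<psi>] x by auto
  ultimately show ?thesis
    by blast
qed

end


section \<open>Cohomology classes of factor sets\<close>

context group
begin

lemma center_closed: "z \<in> center G \<Longrightarrow> z \<in> carrier G"
  and center_commute: "z \<in> center G \<Longrightarrow> g \<in> carrier G \<Longrightarrow> z \<otimes> g = g \<otimes> z"
  by (simp_all add: center_def)

lemma centerI: "z \<in> carrier G \<Longrightarrow> (\<And>g. g \<in> carrier G \<Longrightarrow> z \<otimes> g = g \<otimes> z) \<Longrightarrow> z \<in> center G"
  by (simp add: center_def)

lemma center_left_commute: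
  "z \<in> center G \<Longrightarrow> g \<in> carrier G \<Longrightarrow> h \<in> carrier G \<Longrightarrow> z \<otimes> (g \<otimes> h) = g \<otimes> (z \<otimes> h)"
  using center_commute[of z g] by (simp add: center_closed flip: m_assoc)

lemma center_mult:
  assumes y: "y \<in> center G" and z: "z \<in> center G"
  shows "y \<otimes> z \<in> center G"
proof -
  have "y \<otimes> z \<otimes> g = g \<otimes> (y \<otimes> z)" if g: "g \<in> carrier G" for g
    using center_left_commute[OF y g center_closed[OF z]] center_commute[OF z g] y z g
    by (simp add: center_closed m_assoc)
  then show ?thesis
    using y z by (intro centerI) (simp_all add: center_closed)
qed

lemma center_inv:
  assumes z: "z \<in> center G"
  shows "inv z \<in> center G"
proof -
  have "inv z \<otimes> g = g \<otimes> inv z" if g: "g \<in> carrier G" for g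
  proof -
    have "inv (inv g \<otimes> z) = inv (z \<otimes> inv g)"
      using center_commute[OF z, of "inv g"] g by simp
    then show ?thesis
      using z g by (simp add: inv_mult_group center_closed)
  qed
  then show ?thesis
    using z by (intro centerI) (simp_all add: center_closed)
qed

lemma aut_center:
  assumes \<sigma>: "\<sigma> \<in> carrier (aut_grp G)" and z: "z \<in> center G"
  shows "\<sigma> z \<in> center G"
proof -
  have "\<sigma> z \<otimes> g = g \<otimes> \<sigma> z" if g: "g \<in> carrier G" for g
  proof -
    obtain h where h: "h \<in> carrier G" "g = \<sigma> h"
      using aut_bij[OF \<sigma>] g by (metis bij_betw_def imageE)
    have "\<sigma> (z \<otimes> h) = \<sigma> (h \<otimes> z)"
      using center_commute[OF z h(1)] by simp
    then show ?thesis
      using h z by (simp add: aut_mult[OF \<sigma>] center_closed)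
  qed
  then show ?thesis
    using z by (intro centerI) (simp_all add: center_closed aut_closed[OF \<sigma>])
qed

end

context coupling
begin

section \<open>Factor sets for a fixed \<xi> as translates by central cocycles\<close>

lemma pw_mult_apply [simp]: "u \<in> carrier H \<Longrightarrow> v \<in> carrier H \<Longrightarrow> pw_mult G H \<phi> \<psi> (u, v) = \<phi> (u, v) \<otimes> \<psi> (u, v)"
  and pw_diff_apply [simp]: "u \<in> carrier H \<Longrightarrow> v \<in> carrier H \<Longrightarrow> pw_diff G H \<phi> \<psi> (u, v) = \<phi> (u, v) \<otimes> inv (\<psi> (u, v))"
  by (simp_all add: pw_mult_def pw_diff_def)

lemma eq_pw_mult_iff:
  assumes "\<psi> \<in> extensional (carrier H \<times> carrier H)"
  shows "\<psi> = pw_mult G H \<phi> \<beta> \<longleftrightarrow> (\<forall>u\<in>carrier H. \<forall>v\<in>carrier H. \<psi> (u, v) = \<phi> (u, v) \<otimes> \<beta> (u, v))"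
    (is "_ \<longleftrightarrow> ?R")
proof
  assume ?R
  show "\<psi> = pw_mult G H \<phi> \<beta>"
  proof (rule extensionalityI[OF assms])
    show "\<psi> p = pw_mult G H \<phi> \<beta> p" if "p \<in> carrier H \<times> carrier H" for p
      using that \<open>?R\<close> by (cases p) simp
  qed (simp add: pw_mult_def)
qed simp

lemma Z2_center: "\<zeta> \<in> carrier (Z2 G H \<xi>) \<Longrightarrow> u \<in> carrier H \<Longrightarrow> v \<in> carrier H \<Longrightarrow> \<zeta> (u, v) \<in> center G"
  by (auto simp: Z2_def)

lemma B2_center:
  assumes "\<beta> \<in> B2 G H \<xi>" "u \<in> carrier H" "v \<in> carrier H"
  shows "\<beta> (u, v) \<in> center G"
proof -
  obtain a where a: "a \<in> carrier H \<rightarrow> center G"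
    and \<beta>: "\<beta> = (\<lambda>(u, v)\<in>carrier H \<times> carrier H. \<xi> v (a u) \<otimes> a v \<otimes> inv (a (u \<otimes>\<^bsub>H\<^esub> v)))"
    using assms(1) by (auto simp: B2_def)
  have "a w \<in> center G" if "w \<in> carrier H" for w
    using a that by auto
  then show ?thesis
    using assms G.aut_center[OF xi_closed] by (simp add: \<beta> G.center_mult G.center_inv)
qed

text \<open>Central values cancel in the conjugation of the action law and can be collected in the
  cocycle law, which then splits into the laws for \<phi> and for \<zeta>.\<close>

lemma fs_pw_mult:
  assumes \<phi>: "fs \<phi>" and \<zeta>: "\<zeta> \<in> carrier (Z2 G H \<xi>)"
  shows "fs (pw_mult G H \<phi> \<zeta>)"
proof -
  note [simp] = fs_simps[OF \<phi>]
  have center: "\<zeta> (u, v) \<in> center G" if "u \<in> carrier H" "v \<in> carrier H" for u v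
    using \<zeta> that by (rule Z2_center)
  have [simp]: "\<zeta> (u, v) \<in> carrier G" if "u \<in> carrier H" "v \<in> carrier H" for u v
    using center[OF that] by (rule G.center_closed)
  have one: "\<zeta> (u, \<one>\<^bsub>H\<^esub>) = \<one>" "\<zeta> (\<one>\<^bsub>H\<^esub>, u) = \<one>" if "u \<in> carrier H" for u
    using \<zeta> that by (simp_all add: Z2_def)
  have cocycle: "\<zeta> (u \<otimes>\<^bsub>H\<^esub> v, w) \<otimes> \<xi> w (\<zeta> (u, v)) = \<zeta> (u, v \<otimes>\<^bsub>H\<^esub> w) \<otimes> \<zeta> (v, w)"
    if "u \<in> carrier H" "v \<in> carrier H" "w \<in> carrier H" for u v w
    using \<zeta> that by (simp add: Z2_def)
  have "\<xi> v (\<xi> u g) = inv (\<phi> (u, v) \<otimes> \<zeta> (u, v)) \<otimes> \<xi> (u \<otimes>\<^bsub>H\<^esub> v) g \<otimes> (\<phi> (u, v) \<otimes> \<zeta> (u, v))"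
    if g: "g \<in> carrier G" and uv: "u \<in> carrier H" "v \<in> carrier H" for g u v
  proof -
    have "\<xi> (u \<otimes>\<^bsub>H\<^esub> v) g \<otimes> (\<phi> (u, v) \<otimes> \<zeta> (u, v)) = \<phi> (u, v) \<otimes> \<xi> v (\<xi> u g) \<otimes> \<zeta> (u, v)"
      using fs_xi[OF \<phi> uv g] g uv by (simp flip: G.m_assoc)
    also have "\<dots> = (\<phi> (u, v) \<otimes> \<zeta> (u, v)) \<otimes> \<xi> v (\<xi> u g)"
      using g uv G.center_commute[OF center[OF uv], of "\<xi> v (\<xi> u g)"] by (simp add: G.m_assoc)
    finally show ?thesis
      using g uv by (simp add: G.m_assoc G.inv_mult_group)
  qed
  moreover have "(\<phi> (u \<otimes>\<^bsub>H\<^esub> v, w) \<otimes> \<zeta> (u \<otimes>\<^bsub>H\<^esub> v, w)) \<otimes> \<xi> w (\<phi> (u, v) \<otimes> \<zeta> (u, v)) =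
      (\<phi> (u, v \<otimes>\<^bsub>H\<^esub> w) \<otimes> \<zeta> (u, v \<otimes>\<^bsub>H\<^esub> w)) \<otimes> (\<phi> (v, w) \<otimes> \<zeta> (v, w))"
    if uvw: "u \<in> carrier H" "v \<in> carrier H" "w \<in> carrier H" for u v w
  proof -
    have "(\<phi> (u \<otimes>\<^bsub>H\<^esub> v, w) \<otimes> \<zeta> (u \<otimes>\<^bsub>H\<^esub> v, w)) \<otimes> \<xi> w (\<phi> (u, v) \<otimes> \<zeta> (u, v)) =
        (\<phi> (u \<otimes>\<^bsub>H\<^esub> v, w) \<otimes> \<xi> w (\<phi> (u, v))) \<otimes> (\<zeta> (u \<otimes>\<^bsub>H\<^esub> v, w) \<otimes> \<xi> w (\<zeta> (u, v)))"
      using uvw G.center_left_commute[OF center[of "u \<otimes>\<^bsub>H\<^esub> v" w], of "\<xi> w (\<phi> (u, v))" "\<xi> w (\<zeta> (u, v))"]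
      by (simp add: G.m_assoc)
    also have "\<dots> = (\<phi> (u, v \<otimes>\<^bsub>H\<^esub> w) \<otimes> \<phi> (v, w)) \<otimes> (\<zeta> (u, v \<otimes>\<^bsub>H\<^esub> w) \<otimes> \<zeta> (v, w))"
      using uvw by (simp only: cocycle fs_cocycle[OF \<phi>])
    also have "\<dots> = (\<phi> (u, v \<otimes>\<^bsub>H\<^esub> w) \<otimes> \<zeta> (u, v \<otimes>\<^bsub>H\<^esub> w)) \<otimes> (\<phi> (v, w) \<otimes> \<zeta> (v, w))"
      using uvw G.center_left_commute[OF center[of u "v \<otimes>\<^bsub>H\<^esub> w"], of "\<phi> (v, w)" "\<zeta> (v, w)"]
      by (simp add: G.m_assoc)
    finally show ?thesis .
  qed
  moreover have "pw_mult G H \<phi> \<zeta> \<in> carrier H \<times> carrier H \<rightarrow>\<^sub>E carrier G"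
    by (auto simp: pw_mult_def)
  ultimately show ?thesis
    unfolding factor_set_def by (simp add: one)
qed

text \<open>By the action law \<phi>(u, v) and \<psi>(u, v) conjugate the elements \<xi>(u v) g in
  the same way. As \<xi>(u v) is onto, their quotient is central, and the cocycle law of \<psi> can
  be divided by that of \<phi>.\<close>

lemma pw_diff_Z2:
  assumes \<phi>: "fs \<phi>" and \<psi>: "fs \<psi>"
  shows "pw_diff G H \<psi> \<phi> \<in> carrier (Z2 G H \<xi>)" and "pw_mult G H \<phi> (pw_diff G H \<psi> \<phi>) = \<psi>"
proof -
  note [simp] = fs_simps[OF \<phi>] fs_simps[OF \<psi>]
  define \<zeta> where "\<zeta> = pw_diff G H \<psi> \<phi>"
  have \<zeta>: "\<zeta> (u, v) = \<psi> (u, v) \<otimes> inv (\<phi> (u, v))" if "u \<in> carrier H" "v \<in> carrier H" for u v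
    using that by (simp add: \<zeta>_def)
  then have [simp]: "\<zeta> (u, v) \<in> carrier G" if "u \<in> carrier H" "v \<in> carrier H" for u v
    using that by simp
  have center: "\<zeta> (u, v) \<in> center G" if uv: "u \<in> carrier H" "v \<in> carrier H" for u v
  proof -
    have "\<zeta> (u, v) \<otimes> x = x \<otimes> \<zeta> (u, v)" if x: "x \<in> carrier G" for x
    proof -
      obtain g where g: "g \<in> carrier G" "x = \<xi> (u \<otimes>\<^bsub>H\<^esub> v) g"
        using G.aut_bij[OF xi_closed, of "u \<otimes>\<^bsub>H\<^esub> v"] uv x by (metis H.m_closed bij_betw_def imageE)
      have "\<zeta> (u, v) \<otimes> x = \<psi> (u, v) \<otimes> (inv (\<phi> (u, v)) \<otimes> (x \<otimes> \<phi> (u, v))) \<otimes> inv (\<phi> (u, v))"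
        using uv x by (simp add: \<zeta> G.m_assoc)
      also have "\<dots> = (\<psi> (u, v) \<otimes> \<xi> v (\<xi> u g)) \<otimes> inv (\<phi> (u, v))"
        using uv g by (simp flip: fs_xi[OF \<phi>])
      also have "\<dots> = x \<otimes> \<zeta> (u, v)"
        using uv g by (simp add: fs_xi[OF \<psi>] \<zeta> G.m_assoc)
      finally show ?thesis .
    qed
    then show ?thesis
      using uv by (intro G.centerI) simp_all
  qed
  have \<psi>_eq: "\<psi> (u, v) = \<phi> (u, v) \<otimes> \<zeta> (u, v)" "\<psi> (u, v) = \<zeta> (u, v) \<otimes> \<phi> (u, v)"
    if uv: "u \<in> carrier H" "v \<in> carrier H" for u v
  proof -
    show "\<psi> (u, v) = \<zeta> (u, v) \<otimes> \<phi> (u, v)"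
      using uv by (simp add: \<zeta> G.m_assoc)
    then show "\<psi> (u, v) = \<phi> (u, v) \<otimes> \<zeta> (u, v)"
      using uv G.center_commute[OF center[OF uv], of "\<phi> (u, v)"] by simp
  qed
  have "\<psi> = pw_mult G H \<phi> \<zeta>"
    using fs_funcset[OF \<psi>] \<psi>_eq(1) by (subst eq_pw_mult_iff) (simp_all add: PiE_def)
  then show "pw_mult G H \<phi> (pw_diff G H \<psi> \<phi>) = \<psi>"
    by (simp add: \<zeta>_def)
  have "\<zeta> (u \<otimes>\<^bsub>H\<^esub> v, w) \<otimes> \<xi> w (\<zeta> (u, v)) = \<zeta> (u, v \<otimes>\<^bsub>H\<^esub> w) \<otimes> \<zeta> (v, w)"
    if uvw: "u \<in> carrier H" "v \<in> carrier H" "w \<in> carrier H" for u v w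
  proof -
    \<comment> \<open>By the cocycle law of \<phi>, this is the factor that remains on the right of
      both sides once the central values are collected on the left; cancelling it leaves the law for
      \<zeta>.\<close>
    let ?c = "\<phi> (u, v \<otimes>\<^bsub>H\<^esub> w) \<otimes> \<phi> (v, w)"
    have w\<zeta>: "\<xi> w (\<zeta> (u, v)) \<in> center G"
      using uvw by (simp add: G.aut_center[OF xi_closed] center)
    have "(\<zeta> (u \<otimes>\<^bsub>H\<^esub> v, w) \<otimes> \<xi> w (\<zeta> (u, v))) \<otimes> (\<phi> (u \<otimes>\<^bsub>H\<^esub> v, w) \<otimes> \<xi> w (\<phi> (u, v))) =
        (\<zeta> (u \<otimes>\<^bsub>H\<^esub> v, w) \<otimes> \<phi> (u \<otimes>\<^bsub>H\<^esub> v, w)) \<otimes> \<xi> w (\<zeta> (u, v) \<otimes> \<phi> (u, v))"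
      using uvw G.center_left_commute[OF w\<zeta>, of "\<phi> (u \<otimes>\<^bsub>H\<^esub> v, w)" "\<xi> w (\<phi> (u, v))"]
      by (simp add: G.m_assoc)
    also have "\<dots> = \<psi> (u \<otimes>\<^bsub>H\<^esub> v, w) \<otimes> \<xi> w (\<psi> (u, v))"
      using uvw by (simp only: \<psi>_eq(2) H.m_closed)
    also have "\<dots> = \<psi> (u, v \<otimes>\<^bsub>H\<^esub> w) \<otimes> \<psi> (v, w)"
      using uvw by (rule fs_cocycle[OF \<psi>])
    also have "\<dots> = (\<zeta> (u, v \<otimes>\<^bsub>H\<^esub> w) \<otimes> \<phi> (u, v \<otimes>\<^bsub>H\<^esub> w)) \<otimes> (\<zeta> (v, w) \<otimes> \<phi> (v, w))"
      using uvw by (simp only: \<psi>_eq(2) H.m_closed)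
    also have "\<dots> = (\<zeta> (u, v \<otimes>\<^bsub>H\<^esub> w) \<otimes> \<zeta> (v, w)) \<otimes> ?c"
      using uvw G.center_left_commute[OF center[of v w], of "\<phi> (u, v \<otimes>\<^bsub>H\<^esub> w)" "\<phi> (v, w)"]
      by (simp add: G.m_assoc)
    finally show ?thesis
      using uvw by (simp add: fs_cocycle[OF \<phi>] del: xi_simps(2))
  qed
  moreover have "\<zeta> (u, \<one>\<^bsub>H\<^esub>) = \<one>" "\<zeta> (\<one>\<^bsub>H\<^esub>, u) = \<one>" if "u \<in> carrier H" for u
    using that by (simp_all add: \<zeta>)
  moreover have "\<zeta> \<in> extensional (carrier H \<times> carrier H)"
    by (simp add: \<zeta>_def pw_diff_def)
  ultimately show "pw_diff G H \<psi> \<phi> \<in> carrier (Z2 G H \<xi>)"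
    using center unfolding \<zeta>_def[symmetric] by (auto simp: Z2_def PiE_def)
qed

text \<open>Subtraction multiplies by the inverse on the right, so \<zeta> returns conjugated by a
  value of \<phi>, and centrality removes the conjugation. Asking only for central values makes the
  lemma directly applicable to a coboundary plus a cocycle.\<close>

lemma pw_diff_pw_mult:
  assumes \<phi>: "fs \<phi>" and \<zeta>: "\<zeta> \<in> carrier H \<times> carrier H \<rightarrow>\<^sub>E center G"
  shows "pw_diff G H (pw_mult G H \<phi> \<zeta>) \<phi> = \<zeta>"
proof (rule extensionalityI[of _ "carrier H \<times> carrier H"])
  show "\<zeta> \<in> extensional (carrier H \<times> carrier H)"
    using \<zeta> by (simp add: PiE_def)
  show "pw_diff G H (pw_mult G H \<phi> \<zeta>) \<phi> p = \<zeta> p" if p: "p \<in> carrier H \<times> carrier H" for p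
  proof -
    obtain u v where uv: "p = (u, v)" "u \<in> carrier H" "v \<in> carrier H"
      using p by auto
    have "\<zeta> (u, v) \<in> center G"
      using \<zeta> uv by auto
    then show ?thesis
      using uv G.center_commute[of "\<zeta> (u, v)" "inv (\<phi> (u, v))"]
      by (simp add: fs_simps[OF \<phi>] G.center_closed G.m_assoc)
  qed
qed (simp add: pw_diff_def)

text \<open>For the trivial pair the condition on the lifts says that a(u) commutes with every
  \<xi>(u) g, hence with all of G. With a central, the product equation says that \<psi> is \<phi>
  plus the coboundary of a.\<close>

lemma Gamma_fs_one:
  assumes \<phi>: "fs \<phi>"
  shows "Gamma_fs G H \<xi> \<one>\<^bsub>C\<^esub> \<phi> = pw_mult G H \<phi> ` B2 G H \<xi>"
proof -
  note [simp] = fs_simps[OF \<phi>]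
  define P where "P \<psi> a \<longleftrightarrow> a \<one>\<^bsub>H\<^esub> = \<one> \<and>
      (\<forall>u\<in>carrier H. \<forall>v\<in>carrier H. a (u \<otimes>\<^bsub>H\<^esub> v) \<otimes> \<psi> (u, v) = \<phi> (u, v) \<otimes> \<xi> v (a u) \<otimes> a v)" for \<psi> a
  have central: "(\<forall>g\<in>carrier G. \<xi> u g \<otimes> z = z \<otimes> \<xi> u g) \<longleftrightarrow> z \<in> center G"
    if u: "u \<in> carrier H" and z: "z \<in> carrier G" for u z
  proof -
    have "(\<forall>g\<in>carrier G. \<xi> u g \<otimes> z = z \<otimes> \<xi> u g) \<longleftrightarrow> (\<forall>g\<in>\<xi> u ` carrier G. z \<otimes> g = g \<otimes> z)"
      by auto
    also have "\<xi> u ` carrier G = carrier G"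
      using G.aut_bij[OF xi_closed[OF u]] by (simp add: bij_betw_def)
    finally show ?thesis
      using z by (simp add: center_def)
  qed
  have mem: "\<psi> \<in> Gamma_fs G H \<xi> \<one>\<^bsub>C\<^esub> \<phi> \<longleftrightarrow> \<psi> \<in> carrier H \<times> carrier H \<rightarrow>\<^sub>E carrier G \<and>
      (\<exists>a \<in> carrier H \<rightarrow> center G. P \<psi> a)" (is "_ \<longleftrightarrow> ?R") for \<psi>
  proof -
    have "\<psi> \<in> Gamma_fs G H \<xi> \<one>\<^bsub>C\<^esub> \<phi> \<longleftrightarrow> \<psi> \<in> carrier H \<times> carrier H \<rightarrow>\<^sub>E carrier G \<and>
      (\<exists>a \<in> carrier H \<rightarrow> carrier G. (\<forall>u\<in>carrier H. \<forall>g\<in>carrier G. \<xi> u g \<otimes> a u = a u \<otimes> \<xi> u g) \<and> P \<psi> a)"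
    proof (cases "\<psi> \<in> carrier H \<times> carrier H \<rightarrow>\<^sub>E carrier G")
      case True
      then have "\<psi> (u, v) \<in> carrier G" if "u \<in> carrier H" "v \<in> carrier H" for u v
        using that by auto
      then show ?thesis
        using mem_Gamma_fs_iff[OF \<phi> C.one_closed[unfolded Comp_one], of \<psi>]
        by (simp add: P_def Comp_one conj_ac)
    next
      case False
      then show ?thesis
        using mem_Gamma_fs_iff[OF \<phi> C.one_closed[unfolded Comp_one], of \<psi>] by (simp add: Comp_one)
    qed
    also have "\<dots> \<longleftrightarrow> ?R"
      using central by (fastforce simp: Pi_iff G.center_closed)
    finally show ?thesis .
  qed
  have P_iff: "P \<psi> a \<longleftrightarrow> a \<one>\<^bsub>H\<^esub> = \<one> \<and> \<psi> = pw_mult G H \<phi>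
      (\<lambda>(u, v)\<in>carrier H \<times> carrier H. \<xi> v (a u) \<otimes> a v \<otimes> inv (a (u \<otimes>\<^bsub>H\<^esub> v)))"
    if a: "a \<in> carrier H \<rightarrow> center G" and \<psi>: "\<psi> \<in> carrier H \<times> carrier H \<rightarrow>\<^sub>E carrier G" for \<psi> a
  proof -
    have az: "a u \<in> center G" if "u \<in> carrier H" for u
      using a that by auto
    then have [simp]: "a u \<in> carrier G" if "u \<in> carrier H" for u
      using that G.center_closed by blast
    have "a (u \<otimes>\<^bsub>H\<^esub> v) \<otimes> \<psi> (u, v) = \<phi> (u, v) \<otimes> \<xi> v (a u) \<otimes> a v \<longleftrightarrow>
        \<psi> (u, v) = \<phi> (u, v) \<otimes> (\<xi> v (a u) \<otimes> a v \<otimes> inv (a (u \<otimes>\<^bsub>H\<^esub> v)))"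
      if uv: "u \<in> carrier H" "v \<in> carrier H" for u v
    proof -
      have [simp]: "\<psi> (u, v) \<in> carrier G"
        using \<psi> uv by auto
      \<comment> \<open>The product equation has a(u v) on the left, the coboundary has its inverse
        on the right; centrality bridges the two.\<close>
      have "a (u \<otimes>\<^bsub>H\<^esub> v) \<otimes> \<psi> (u, v) = \<psi> (u, v) \<otimes> a (u \<otimes>\<^bsub>H\<^esub> v)"
        using uv by (intro G.center_commute az) auto
      moreover have "\<psi> (u, v) \<otimes> a (u \<otimes>\<^bsub>H\<^esub> v) = \<phi> (u, v) \<otimes> \<xi> v (a u) \<otimes> a v \<longleftrightarrow>
          \<psi> (u, v) = \<phi> (u, v) \<otimes> \<xi> v (a u) \<otimes> a v \<otimes> inv (a (u \<otimes>\<^bsub>H\<^esub> v))"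
        using uv by (subst G.inv_solve_right) auto
      moreover have "\<phi> (u, v) \<otimes> \<xi> v (a u) \<otimes> a v \<otimes> inv (a (u \<otimes>\<^bsub>H\<^esub> v)) =
          \<phi> (u, v) \<otimes> (\<xi> v (a u) \<otimes> a v \<otimes> inv (a (u \<otimes>\<^bsub>H\<^esub> v)))"
        using uv by (simp add: G.m_assoc)
      ultimately show ?thesis
        by (simp only:)
    qed
    then have "P \<psi> a \<longleftrightarrow> a \<one>\<^bsub>H\<^esub> = \<one> \<and> (\<forall>u\<in>carrier H. \<forall>v\<in>carrier H.
        \<psi> (u, v) = \<phi> (u, v) \<otimes> (\<xi> v (a u) \<otimes> a v \<otimes> inv (a (u \<otimes>\<^bsub>H\<^esub> v))))"
      by (simp add: P_def)
    also have "\<dots> \<longleftrightarrow> a \<one>\<^bsub>H\<^esub> = \<one> \<and> \<psi> = pw_mult G H \<phi>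
        (\<lambda>(u, v)\<in>carrier H \<times> carrier H. \<xi> v (a u) \<otimes> a v \<otimes> inv (a (u \<otimes>\<^bsub>H\<^esub> v)))"
      using \<psi> by (simp add: eq_pw_mult_iff PiE_def)
    finally show ?thesis .
  qed
  have closed: "pw_mult G H \<phi> \<beta> \<in> carrier H \<times> carrier H \<rightarrow>\<^sub>E carrier G" if "\<beta> \<in> B2 G H \<xi>" for \<beta>
    using B2_center[OF that] by (auto simp: pw_mult_def G.center_closed)
  show ?thesis
  proof (intro equalityI subsetI)
    fix \<psi> assume "\<psi> \<in> Gamma_fs G H \<xi> \<one>\<^bsub>C\<^esub> \<phi>"
    then obtain a where \<psi>: "\<psi> \<in> carrier H \<times> carrier H \<rightarrow>\<^sub>E carrier G"
      and a: "a \<in> carrier H \<rightarrow> center G" and P: "P \<psi> a"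
      unfolding mem by (elim conjE bexE)
    from P[unfolded P_iff[OF a \<psi>]] a show "\<psi> \<in> pw_mult G H \<phi> ` B2 G H \<xi>"
      unfolding B2_def by (intro image_eqI[OF conjunct2]) auto
  next
    fix \<psi> assume "\<psi> \<in> pw_mult G H \<phi> ` B2 G H \<xi>"
    then obtain \<beta> where \<beta>: "\<beta> \<in> B2 G H \<xi>" and \<psi>_eq: "\<psi> = pw_mult G H \<phi> \<beta>"
      by (elim imageE)
    obtain a where a: "a \<in> carrier H \<rightarrow> center G" "a \<one>\<^bsub>H\<^esub> = \<one>"
      and \<beta>_eq: "\<beta> = (\<lambda>(u, v)\<in>carrier H \<times> carrier H. \<xi> v (a u) \<otimes> a v \<otimes> inv (a (u \<otimes>\<^bsub>H\<^esub> v)))"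
      using \<beta> unfolding B2_def by (elim CollectE exE conjE)
    have \<psi>: "\<psi> \<in> carrier H \<times> carrier H \<rightarrow>\<^sub>E carrier G"
      using closed[OF \<beta>] by (simp only: \<psi>_eq)
    have "P \<psi> a"
      unfolding P_iff[OF a(1) \<psi>] using a(2) \<psi>_eq \<beta>_eq by (simp only: simp_thms)
    then show "\<psi> \<in> Gamma_fs G H \<xi> \<one>\<^bsub>C\<^esub> \<phi>"
      unfolding mem using a(1) \<psi> by (intro conjI bexI[of _ a])
  qed
qed

section \<open>Cohomology classes as shifted values of \<Gamma>\<close>

lemma coho_class_eq: "coho_class G H \<xi> \<zeta> = (\<lambda>\<beta>. pw_mult G H \<beta> \<zeta>) ` B2 G H \<xi>"
  by (auto simp: coho_class_def r_coset_def Z2_def)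

lemma pw_mult_coho_class:
  assumes \<phi>: "fs \<phi>" and \<zeta>: "\<zeta> \<in> carrier (Z2 G H \<xi>)"
  shows "pw_mult G H \<phi> ` coho_class G H \<xi> \<zeta> = Gamma_fs G H \<xi> \<one>\<^bsub>C\<^esub> (pw_mult G H \<phi> \<zeta>)"
proof -
  have "pw_mult G H \<phi> (pw_mult G H \<beta> \<zeta>) = pw_mult G H (pw_mult G H \<phi> \<zeta>) \<beta>" if \<beta>: "\<beta> \<in> B2 G H \<xi>" for \<beta>
    unfolding pw_mult_def
  proof (rule restrict_ext)
    fix p assume "p \<in> carrier H \<times> carrier H"
    then show "\<phi> p \<otimes> (\<lambda>p\<in>carrier H \<times> carrier H. \<beta> p \<otimes> \<zeta> p) p = (\<lambda>p\<in>carrier H \<times> carrier H. \<phi> p \<otimes> \<zeta> p) p \<otimes> \<beta> p"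
      using B2_center[OF \<beta>] Z2_center[OF \<zeta>] fs_closed[OF \<phi>]
      by (auto simp: G.m_assoc G.center_closed G.center_commute[of "\<beta> _"])
  qed
  then show ?thesis
    by (simp add: Gamma_fs_one[OF fs_pw_mult[OF assms]] coho_class_eq image_image)
qed

text \<open>With this, a class and its image under \<open>Gamma_shift\<close> both become shifts of
  sets of the form \<open>Gamma_fs\<close>, and can be compared before the shift.\<close>

lemma coho_class_eq_pw_diff:
  assumes \<phi>: "fs \<phi>" and \<zeta>: "\<zeta> \<in> carrier (Z2 G H \<xi>)"
  shows "coho_class G H \<xi> \<zeta> = (\<lambda>\<psi>. pw_diff G H \<psi> \<phi>) ` Gamma_fs G H \<xi> \<one>\<^bsub>C\<^esub> (pw_mult G H \<phi> \<zeta>)"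
proof -
  have "pw_diff G H (pw_mult G H \<phi> \<chi>) \<phi> = \<chi>" if \<chi>: "\<chi> \<in> coho_class G H \<xi> \<zeta>" for \<chi>
  proof (rule pw_diff_pw_mult[OF \<phi>])
    obtain \<beta> where \<beta>: "\<beta> \<in> B2 G H \<xi>" and \<chi>_eq: "\<chi> = pw_mult G H \<beta> \<zeta>"
      using \<chi> by (auto simp: coho_class_eq)
    show "\<chi> \<in> carrier H \<times> carrier H \<rightarrow>\<^sub>E center G"
      using B2_center[OF \<beta>] Z2_center[OF \<zeta>] by (auto simp: \<chi>_eq pw_mult_def intro: G.center_mult)
  qed
  then show ?thesis
    by (simp add: image_image flip: pw_mult_coho_class[OF assms])
qed

text \<open>The translate of the class by \<phi> is \<Gamma>(1) of \<phi> + \<zeta>, so the union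
  over the class collapses by the composition law for 1 and x.\<close>

lemma Gamma_shift_coho_class:
  assumes \<phi>: "fs \<phi>" and x: "x \<in> carrier C" and \<zeta>: "\<zeta> \<in> carrier (Z2 G H \<xi>)"
  shows "Gamma_shift G H \<xi> \<phi> x (coho_class G H \<xi> \<zeta>) =
    (\<lambda>\<psi>. pw_diff G H \<psi> \<phi>) ` Gamma_fs G H \<xi> x (pw_mult G H \<phi> \<zeta>)"
  using Gamma_fs_mult[OF fs_pw_mult[OF \<phi> \<zeta>] C.one_closed x] x
  by (simp only: Gamma_shift_def pw_mult_coho_class[OF \<phi> \<zeta>] C.l_one)

text \<open>The shift can be undone on factor sets, so the question is whether \<Gamma>(x) of \<phi>
  + \<zeta> equals the coset of \<phi> + \<zeta>'. As the former is itself a coset, this is decided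
  by the single element \<phi> + \<zeta>'. All statements about the action are read off from this
  equivalence.\<close>

lemma Gamma_shift_eq_iff:
  assumes \<phi>: "fs \<phi>" and x: "x \<in> carrier C"
    and \<zeta>: "\<zeta> \<in> carrier (Z2 G H \<xi>)" and \<zeta>': "\<zeta>' \<in> carrier (Z2 G H \<xi>)"
  shows "Gamma_shift G H \<xi> \<phi> x (coho_class G H \<xi> \<zeta>) = coho_class G H \<xi> \<zeta>' \<longleftrightarrow>
    (\<exists>\<alpha>\<in>Isos (pw_mult G H \<phi> \<zeta>) (pw_mult G H \<phi> \<zeta>'). induced_pair G H \<alpha> = x)"
proof -
  let ?\<psi> = "pw_mult G H \<phi> \<zeta>" and ?\<psi>' = "pw_mult G H \<phi> \<zeta>'" and ?d = "\<lambda>\<psi>. pw_diff G H \<psi> \<phi>"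
  have fs: "fs ?\<psi>" "fs ?\<psi>'"
    by (rule fs_pw_mult; fact)+
  have inj: "inj_on ?d (Collect fs)"
    by (rule inj_on_inverseI[where g = "pw_mult G H \<phi>"]) (simp add: pw_diff_Z2(2)[OF \<phi>])
  have "Gamma_shift G H \<xi> \<phi> x (coho_class G H \<xi> \<zeta>) = coho_class G H \<xi> \<zeta>' \<longleftrightarrow>
      ?d ` Gamma_fs G H \<xi> x ?\<psi> = ?d ` Gamma_fs G H \<xi> \<one>\<^bsub>C\<^esub> ?\<psi>'"
    by (simp only: Gamma_shift_coho_class[OF \<phi> x \<zeta>] coho_class_eq_pw_diff[OF \<phi> \<zeta>'])
  also have "\<dots> \<longleftrightarrow> Gamma_fs G H \<xi> x ?\<psi> = Gamma_fs G H \<xi> \<one>\<^bsub>C\<^esub> ?\<psi>'"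
    using Gamma_fs_fs[OF fs(1) x] Gamma_fs_fs[OF fs(2) C.one_closed] by (intro inj_on_image_eq_iff[OF inj]) auto
  also have "\<dots> \<longleftrightarrow> ?\<psi>' \<in> Gamma_fs G H \<xi> x ?\<psi>"
  proof -
    have "?\<psi>' \<in> Gamma_fs G H \<xi> \<one>\<^bsub>C\<^esub> ?\<psi>'"
      using G_iso_id[OF fs(2)] fs(2) by (auto simp: Gamma_fs_eq)
    then show ?thesis
      using Gamma_fs_eq_coset[OF fs(1) x] by blast
  qed
  also have "\<dots> \<longleftrightarrow> (\<exists>\<alpha>\<in>Isos ?\<psi> ?\<psi>'. induced_pair G H \<alpha> = x)"
    using fs by (simp add: Gamma_fs_eq[OF fs(1) x])
  finally show ?thesis .
qed

lemma carrier_H2: "carrier (H2 G H \<xi>) = coho_class G H \<xi> ` carrier (Z2 G H \<xi>)"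
  by (auto simp: H2_def FactGroup_def RCOSETS_def coho_class_def)

lemma Gamma_shift_closed:
  assumes \<phi>: "fs \<phi>" and x: "x \<in> carrier C" and \<zeta>: "\<zeta> \<in> carrier (Z2 G H \<xi>)"
  obtains \<zeta>' where "\<zeta>' \<in> carrier (Z2 G H \<xi>)"
    "Gamma_shift G H \<xi> \<phi> x (coho_class G H \<xi> \<zeta>) = coho_class G H \<xi> \<zeta>'"
proof -
  have fs: "fs (pw_mult G H \<phi> \<zeta>)"
    using \<phi> \<zeta> by (rule fs_pw_mult)
  then obtain \<psi> where \<psi>: "\<psi> \<in> Gamma_fs G H \<xi> x (pw_mult G H \<phi> \<zeta>)"
    using Gamma_fs_nonempty x by blast
  then have fs\<psi>: "fs \<psi>" and iso: "\<exists>\<alpha>\<in>Isos (pw_mult G H \<phi> \<zeta>) \<psi>. induced_pair G H \<alpha> = x"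
    by (simp_all add: Gamma_fs_eq[OF fs x])
  \<comment> \<open>The new representative is \<psi> - \<phi> for any \<psi> in \<Gamma>(x); adding
    \<phi> gives back \<psi>.\<close>
  note d = pw_diff_Z2[OF \<phi> fs\<psi>]
  show ?thesis
    using that[OF d(1)] Gamma_shift_eq_iff[OF \<phi> x \<zeta> d(1)] iso d(2) by simp
qed

text \<open>Through \<open>Gamma_shift_eq_iff\<close>, the unit law asks for an isomorphism inducing
  the trivial pair, which is the identity, and the product law asks for one inducing x y, which is a
  composite.\<close>

lemma Gamma_right_action:
  assumes \<phi>: "fs \<phi>"
  shows "right_action C (carrier (H2 G H \<xi>)) (Gamma_shift G H \<xi> \<phi>)"
  unfolding right_action_def carrier_H2
proof (intro conjI ballI)
  show "group C"
    by unfold_locales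
next
  fix x c assume x: "x \<in> carrier C" and "c \<in> coho_class G H \<xi> ` carrier (Z2 G H \<xi>)"
  then obtain \<zeta> where \<zeta>: "\<zeta> \<in> carrier (Z2 G H \<xi>)" "c = coho_class G H \<xi> \<zeta>"
    by blast
  then show "Gamma_shift G H \<xi> \<phi> x c \<in> coho_class G H \<xi> ` carrier (Z2 G H \<xi>)"
    using Gamma_shift_closed[OF \<phi> x \<zeta>(1)] by (metis imageI)
next
  fix c assume "c \<in> coho_class G H \<xi> ` carrier (Z2 G H \<xi>)"
  then obtain \<zeta> where \<zeta>: "\<zeta> \<in> carrier (Z2 G H \<xi>)" "c = coho_class G H \<xi> \<zeta>"
    by blast
  then show "Gamma_shift G H \<xi> \<phi> \<one>\<^bsub>C\<^esub> c = c"
    using G_iso_id[OF fs_pw_mult[OF \<phi> \<zeta>(1)]] Gamma_shift_eq_iff[OF \<phi> C.one_closed \<zeta>(1) \<zeta>(1)] by blast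
next
  fix x y c assume x: "x \<in> carrier C" and y: "y \<in> carrier C"
    and "c \<in> coho_class G H \<xi> ` carrier (Z2 G H \<xi>)"
  then obtain \<zeta> where \<zeta>: "\<zeta> \<in> carrier (Z2 G H \<xi>)" and c: "c = coho_class G H \<xi> \<zeta>"
    by blast
  obtain \<zeta>' where \<zeta>': "\<zeta>' \<in> carrier (Z2 G H \<xi>)"
    and 1: "Gamma_shift G H \<xi> \<phi> x (coho_class G H \<xi> \<zeta>) = coho_class G H \<xi> \<zeta>'"
    using Gamma_shift_closed[OF \<phi> x \<zeta>] by blast
  obtain \<zeta>'' where \<zeta>'': "\<zeta>'' \<in> carrier (Z2 G H \<xi>)"
    and 2: "Gamma_shift G H \<xi> \<phi> y (coho_class G H \<xi> \<zeta>') = coho_class G H \<xi> \<zeta>''"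
    using Gamma_shift_closed[OF \<phi> y \<zeta>'] by blast
  obtain \<alpha> where \<alpha>: "\<alpha> \<in> Isos (pw_mult G H \<phi> \<zeta>) (pw_mult G H \<phi> \<zeta>')" "induced_pair G H \<alpha> = x"
    using 1 Gamma_shift_eq_iff[OF \<phi> x \<zeta> \<zeta>'] by blast
  obtain \<beta> where \<beta>: "\<beta> \<in> Isos (pw_mult G H \<phi> \<zeta>') (pw_mult G H \<phi> \<zeta>'')" "induced_pair G H \<beta> = y"
    using 2 Gamma_shift_eq_iff[OF \<phi> y \<zeta>' \<zeta>''] by blast
  note fs = fs_pw_mult[OF \<phi> \<zeta>] fs_pw_mult[OF \<phi> \<zeta>'] fs_pw_mult[OF \<phi> \<zeta>'']
  have "Gamma_shift G H \<xi> \<phi> (x \<otimes>\<^bsub>C\<^esub> y) (coho_class G H \<xi> \<zeta>) = coho_class G H \<xi> \<zeta>''"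
    using Gamma_shift_eq_iff[OF \<phi> C.m_closed[OF x y] \<zeta> \<zeta>''] G_iso_compose[OF fs \<alpha>(1) \<beta>(1)] \<alpha>(2) \<beta>(2)
    by metis
  then show "Gamma_shift G H \<xi> \<phi> (x \<otimes>\<^bsub>C\<^esub> y) c = Gamma_shift G H \<xi> \<phi> y (Gamma_shift G H \<xi> \<phi> x c)"
    by (simp only: c 1 2)
qed

lemma Gamma_orbits_iff:
  assumes \<phi>: "fs \<phi>" and \<zeta>: "\<zeta> \<in> carrier (Z2 G H \<xi>)" and \<zeta>': "\<zeta>' \<in> carrier (Z2 G H \<xi>)"
  shows "G_isomorphic G H (E (pw_mult G H \<phi> \<zeta>)) (E (pw_mult G H \<phi> \<zeta>')) \<longleftrightarrow>
    (\<exists>O'\<in>orbits C (carrier (H2 G H \<xi>)) (Gamma_shift G H \<xi> \<phi>).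
      coho_class G H \<xi> \<zeta> \<in> O' \<and> coho_class G H \<xi> \<zeta>' \<in> O')" (is "?L \<longleftrightarrow> ?R")
proof
  let ?act = "Gamma_shift G H \<xi> \<phi>" and ?c = "coho_class G H \<xi>"
  note act = Gamma_right_action[OF \<phi>, unfolded right_action_def]
  have c: "?c \<zeta> \<in> carrier (H2 G H \<xi>)" "?c \<zeta>' \<in> carrier (H2 G H \<xi>)"
    using \<zeta> \<zeta>' by (simp_all add: carrier_H2)
  note fs = fs_pw_mult[OF \<phi> \<zeta>] fs_pw_mult[OF \<phi> \<zeta>']
  {
    assume ?L
    then obtain \<alpha> where \<alpha>: "\<alpha> \<in> Isos (pw_mult G H \<phi> \<zeta>) (pw_mult G H \<phi> \<zeta>')"
      by (auto simp: G_isomorphic_def)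
    let ?x = "induced_pair G H \<alpha>"
    have x: "?x \<in> carrier C"
      using induced_pair_in_Comp[OF fs \<alpha>] .
    have "?act ?x (?c \<zeta>) = ?c \<zeta>'" "?act \<one>\<^bsub>C\<^esub> (?c \<zeta>) = ?c \<zeta>"
      using Gamma_shift_eq_iff[OF \<phi> x \<zeta> \<zeta>'] \<alpha> act c by auto
    then have "?c \<zeta> \<in> orbit C ?act (?c \<zeta>)" "?c \<zeta>' \<in> orbit C ?act (?c \<zeta>)"
      unfolding orbit_def using x C.one_closed by (metis (mono_tags, lifting) mem_Collect_eq)+
    then show ?R
      using c(1) unfolding orbits_def by blast
  next
    assume ?R
    then obtain c0 x y where c0: "c0 \<in> carrier (H2 G H \<xi>)" and x: "x \<in> carrier C" and y: "y \<in> carrier C"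
      and eq: "?c \<zeta> = ?act x c0" "?c \<zeta>' = ?act y c0"
      by (auto simp: orbits_def orbit_def)
    \<comment> \<open>Both classes are reached from a common base point c0 of the orbit. Returning
      from the first to c0 and going on to the second gives one pair between them.\<close>
    have "?act (inv\<^bsub>C\<^esub> x) (?c \<zeta>) = c0"
      using act x c0 by (metis C.inv_closed C.r_inv eq(1))
    then have "?act (inv\<^bsub>C\<^esub> x \<otimes>\<^bsub>C\<^esub> y) (?c \<zeta>) = ?c \<zeta>'"
      using act x y c(1) by (metis C.inv_closed eq(2))
    then show ?L
      using Gamma_shift_eq_iff[OF \<phi> _ \<zeta> \<zeta>', of "inv\<^bsub>C\<^esub> x \<otimes>\<^bsub>C\<^esub> y"] x y by (auto simp: G_isomorphic_def)
  }
qed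

lemma inducible_subgroup:
  assumes \<phi>: "fs \<phi>"
  shows "subgroup (inducible_pairs G H \<Phi> (E \<phi>)) C"
proof (rule C.subgroupI)
  have "\<one>\<^bsub>C\<^esub> \<in> inducible_pairs G H \<Phi> (E \<phi>)"
    using G_iso_id[OF \<phi>] C.one_closed unfolding inducible_pairs_def by blast
  then show "inducible_pairs G H \<Phi> (E \<phi>) \<noteq> {}"
    by blast
  show "inv\<^bsub>C\<^esub> x \<in> inducible_pairs G H \<Phi> (E \<phi>)" if mem: "x \<in> inducible_pairs G H \<Phi> (E \<phi>)" for x
  proof -
    obtain \<alpha> where \<alpha>: "\<alpha> \<in> Isos \<phi> \<phi>" "induced_pair G H \<alpha> = x" and x: "x \<in> carrier C"
      using mem unfolding inducible_pairs_def by blast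
    show ?thesis
      using G_iso_inv[OF \<phi> \<phi> \<alpha>(1)] C.inv_closed[OF x] \<alpha>(2) unfolding inducible_pairs_def by blast
  qed
  show "x \<otimes>\<^bsub>C\<^esub> y \<in> inducible_pairs G H \<Phi> (E \<phi>)"
    if mem: "x \<in> inducible_pairs G H \<Phi> (E \<phi>)" "y \<in> inducible_pairs G H \<Phi> (E \<phi>)" for x y
  proof -
    obtain \<alpha> \<beta> where \<alpha>: "\<alpha> \<in> Isos \<phi> \<phi>" "induced_pair G H \<alpha> = x" and \<beta>: "\<beta> \<in> Isos \<phi> \<phi>" "induced_pair G H \<beta> = y"
      and xy: "x \<in> carrier C" "y \<in> carrier C"
      using mem unfolding inducible_pairs_def by blast
    show ?thesis
      using G_iso_compose[OF \<phi> \<phi> \<phi> \<alpha>(1) \<beta>(1)] C.m_closed[OF xy] \<alpha>(2) \<beta>(2) unfolding inducible_pairs_def by blast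
  qed
qed (auto simp: inducible_pairs_def)

text \<open>The case \<zeta>' = \<zeta> of \<open>Gamma_shift_eq_iff\<close>.\<close>

lemma stabilizer_eq_inducible:
  assumes "fs \<phi>" and "\<zeta> \<in> carrier (Z2 G H \<xi>)"
  shows "stabilizer C (Gamma_shift G H \<xi> \<phi>) (coho_class G H \<xi> \<zeta>) =
    inducible_pairs G H \<Phi> (E (pw_mult G H \<phi> \<zeta>))"
  using Gamma_shift_eq_iff[OF assms(1) _ assms(2) assms(2)]
  by (auto simp: stabilizer_def inducible_pairs_def)

text \<open>The pair \<open>(c\<^sub>h, l)\<close> is induced by conjugation with \<open>(h, t)\<close>, where \<open>l = \<xi>(h) c\<^sub>t\<close>.\<close>

lemma Inn_T_inducible:
  assumes \<phi>: "fs \<phi>"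
  shows "Inn_T G H \<Phi> \<subseteq> inducible_pairs G H \<Phi> (E \<phi>)"
proof
  fix x assume x_mem: "x \<in> Inn_T G H \<Phi>"
  then obtain h l where x: "x = (conj_by H h, l)" and h: "h \<in> carrier H" and l: "l \<in> \<Phi> h" "l \<in> carrier \<A>\<^sub>G"
    by (auto simp: Inn_T_def T_set_def)
  then obtain t where t: "t \<in> carrier G" and l_eq: "\<And>g. g \<in> carrier G \<Longrightarrow> l g = inv t \<otimes> \<xi> h g \<otimes> t"
    using mem_Phi_iff by auto
  interpret E: group "E \<phi>"
    by (rule group_ext) fact
  interpret AE: group "aut_grp (E \<phi>)"
    by (rule E.group_aut_grp)
  let ?\<alpha> = "conj_by (E \<phi>) (h, t)"
  have ht: "(h, t) \<in> carrier (E \<phi>)"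
    using h t by simp
  have \<alpha>: "?\<alpha> \<in> carrier (aut_grp (E \<phi>))"
    using ht by (rule E.conj_by_aut)
  have \<alpha>_g: "?\<alpha> (\<one>\<^bsub>H\<^esub>, g) = (\<one>\<^bsub>H\<^esub>, l g)" if "g \<in> carrier G" for g
    using conj_by_ext[OF \<phi> h t that] l_eq[OF that] by simp
  have fst_mult: "fst (p \<otimes>\<^bsub>E \<phi>\<^esub> q) = fst p \<otimes>\<^bsub>H\<^esub> fst q" for p q
    by (cases p; cases q) simp
  \<comment> \<open>The projection to H is multiplicative, which determines this coordinate without
    a formula for the inverse in the extension.\<close>
  have fst_inv: "fst (inv\<^bsub>E \<phi>\<^esub> (h, t)) = inv\<^bsub>H\<^esub> h"
  proof (rule H.inv_equality[symmetric])
    show "fst (inv\<^bsub>E \<phi>\<^esub> (h, t)) \<otimes>\<^bsub>H\<^esub> h = \<one>\<^bsub>H\<^esub>"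
      using fst_mult[of "inv\<^bsub>E \<phi>\<^esub> (h, t)" "(h, t)"] E.l_inv[OF ht] by simp
    show "fst (inv\<^bsub>E \<phi>\<^esub> (h, t)) \<in> carrier H"
      using E.inv_closed[OF ht] by (simp add: mem_Times_iff)
  qed fact
  have "?\<alpha> ` kernel_copy G H = Pair \<one>\<^bsub>H\<^esub> ` l ` carrier G"
    using \<alpha>_g by (force simp: kernel_copy_def)
  then have "?\<alpha> ` kernel_copy G H = kernel_copy G H"
    using G.aut_bij[OF l(2)] by (auto simp: kernel_copy_def bij_betw_def)
  then have iso: "?\<alpha> \<in> Isos \<phi> \<phi>"
    using \<alpha> by (simp add: G_isos_def iso_def aut_grp_def AutoGroup_def auto_def Bij_def)
  have "fst (?\<alpha> (u, \<one>)) = conj_by H h u" if "u \<in> carrier H" for u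
    using that ht by (simp add: fst_mult fst_inv del: ext_mult)
  then have "induced_pair G H ?\<alpha> = x"
    using l(2) \<alpha>_g by (auto simp: induced_pair_def x conj_by_def aut_grp_def AutoGroup_def auto_def Bij_def
        cong: restrict_cong intro: extensional_restrict)
  then show "x \<in> inducible_pairs G H \<Phi> (E \<phi>)"
    using iso x_mem Inn_T_subgroup C.subgroupE(1) by (auto simp: inducible_pairs_def)
qed

end

text \<open>\<open>Gamma_shift\<close> is defined on a class by a union over all its members; the
  first conjunct ties it to a single representative, as in the formula for the shifted \<Gamma>.
  Both subgroup claims are part of what is meant by the third and fourth assertions.\<close>

theorem theorem6p3p4:
  fixes G :: "('g, 'm) monoid_scheme" and H :: "('h, 'n) monoid_scheme"
    and \<Phi> :: "'h \<Rightarrow> ('g \<Rightarrow> 'g) set" and \<xi> :: "'h \<Rightarrow> 'g \<Rightarrow> 'g"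
    and \<phi> \<zeta>1 \<zeta>2 :: "'h \<times> 'h \<Rightarrow> 'g"
  assumes "group G" and "group H"
    and "\<Phi> \<in> hom H (out_grp G)"
    and "\<xi> \<in> carrier H \<rightarrow> carrier (aut_grp G)" and "\<xi> \<one>\<^bsub>H\<^esub> = \<one>\<^bsub>aut_grp G\<^esub>"
    and "factor_set G H \<xi> \<phi>"
    and "has_coupling H \<xi> \<Phi>"
    and "\<zeta>1 \<in> carrier (Z2 G H \<xi>)" and "\<zeta>2 \<in> carrier (Z2 G H \<xi>)"
  shows "((\<forall>x\<in>carrier (Comp G H \<Phi>). \<forall>\<zeta>\<in>carrier (Z2 G H \<xi>).
             Gamma_shift G H \<xi> \<phi> x (coho_class G H \<xi> \<zeta>) =
             (\<lambda>\<psi>. pw_diff G H \<psi> \<phi>) ` Gamma_fs G H \<xi> x (pw_mult G H \<phi> \<zeta>)) \<and>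
          right_action (Comp G H \<Phi>) (carrier (H2 G H \<xi>)) (Gamma_shift G H \<xi> \<phi>)) \<and>
         (G_isomorphic G H (ext G H \<xi> (pw_mult G H \<phi> \<zeta>1)) (ext G H \<xi> (pw_mult G H \<phi> \<zeta>2)) \<longleftrightarrow>
          (\<exists>O'\<in>orbits (Comp G H \<Phi>) (carrier (H2 G H \<xi>)) (Gamma_shift G H \<xi> \<phi>).
             coho_class G H \<xi> \<zeta>1 \<in> O' \<and> coho_class G H \<xi> \<zeta>2 \<in> O')) \<and>
         (subgroup (inducible_pairs G H \<Phi> (ext G H \<xi> (pw_mult G H \<phi> \<zeta>1))) (Comp G H \<Phi>) \<and>
          stabilizer (Comp G H \<Phi>) (Gamma_shift G H \<xi> \<phi>) (coho_class G H \<xi> \<zeta>1) =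
          inducible_pairs G H \<Phi> (ext G H \<xi> (pw_mult G H \<phi> \<zeta>1))) \<and>
         (subgroup (Inn_T G H \<Phi>) (Comp G H \<Phi>) \<and>
          (\<forall>x\<in>Inn_T G H \<Phi>. \<forall>c\<in>carrier (H2 G H \<xi>). Gamma_shift G H \<xi> \<phi> x c = c))"
proof -
  interpret coupling G H \<Phi> \<xi>
    by (rule coupling.intro, fact, fact, rule coupling_axioms.intro) fact+
  note \<phi> = \<open>factor_set G H \<xi> \<phi>\<close> and \<zeta>1 = \<open>\<zeta>1 \<in> carrier (Z2 G H \<xi>)\<close> and \<zeta>2 = \<open>\<zeta>2 \<in> carrier (Z2 G H \<xi>)\<close>
  have "Gamma_shift G H \<xi> \<phi> x c = c" if x: "x \<in> Inn_T G H \<Phi>" and c: "c \<in> carrier (H2 G H \<xi>)" for x c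
  proof -
    obtain \<zeta> where \<zeta>: "\<zeta> \<in> carrier (Z2 G H \<xi>)" "c = coho_class G H \<xi> \<zeta>"
      using c by (auto simp: carrier_H2)
    \<comment> \<open>Pairs from \<open>Inn_T\<close> are inducible for every extension with factor
      set \<phi> + \<zeta>, so they lie in the stabilizer of every class.\<close>
    then have "x \<in> stabilizer C (Gamma_shift G H \<xi> \<phi>) c"
      using x Inn_T_inducible[OF fs_pw_mult[OF \<phi> \<zeta>(1)]] stabilizer_eq_inducible[OF \<phi> \<zeta>(1)] by auto
    then show ?thesis
      by (simp add: stabilizer_def)
  qed
  then show ?thesis
    using Gamma_shift_coho_class[OF \<phi>] Gamma_right_action[OF \<phi>] Gamma_orbits_iff[OF \<phi> \<zeta>1 \<zeta>2]
      inducible_subgroup[OF fs_pw_mult[OF \<phi> \<zeta>1]] stabilizer_eq_inducible[OF \<phi> \<zeta>1] Inn_T_subgroup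
    by (intro conjI ballI)
qed

end
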